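(* Let $M$ be a separable spherically complete ultrametric space with a distinguished point $0$, and let $Y\subset\mathrm{Lip}_0(M)$ be the predual of $\mathcal{F}(M)$ associated with a fixed one-to-one dense sequence $S=\{s_n:n\in\mathbb{N}\}$ in $M$ with $s_1=0$. Then $Y$ is $M$-embedded if and only if $M$ is proper.
   Context: All Banach spaces are real. A metric space $(M,d)$ is ultrametric if $d(x,y)\le\max\{d(x,z),d(z,y)\}$ for all $x,y,z\in M$. It is spherically complete if every nested (i.e. decreasing) sequence of balls of positive radius has nonempty intersection. A metric space is proper if every closed ball is compact. $\mathrm{Lip}_0(M)$ is the Banach space of Lipschitz functions $f\colon M\to\mathbb{R}$ with $f(0)=0$, normed by the best Lipschitz constant. $\mathcal{F}(M)$ is the closed linear span in $\mathrm{Lip}_0(M)^*$ of the evaluations $\delta_x(f)=f(x)$, $x\in M$; $\mathcal{F}(M)^*=\mathrm{Lip}_0(M)$. Definition of $Y$: fix a one-to-one sequence $(s_n)_{n\in\mathbb{N}}$ with dense range $S$ in $M$ and $s_1=0$. For $n\in\mathbb{N}$, $x\in M$ let $S_n=\{s_1,\dots,s_n\}$, $i_n(x)=\min\{k\le n: d(x,S_n)=d(x,s_k)\}$, where $d(x,S_n)=\min_{k\le n}d(x,s_k)$, and $r_n\colon M\to S_n$, $r_n(x)=s_{i_n(x)}$. Then $Y$ is the set of all $f\in\mathrm{Lip}_0(M)$ such that for every $\varepsilon>0$ there is $N\in\mathbb{N}$ such that for all $x,y\in M$, $r_N(x)=r_N(y)$ implies $|f(x)-f(y)|\le\varepsilon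 d(x,y)$; it carries the norm of $\mathrm{Lip}_0(M)$ and is a closed subspace of it. For separable spherically complete $M$, $Y$ is a predual of $\mathcal{F}(M)$, i.e. $Y^*=\mathcal{F}(M)$ isometrically via evaluation, and $Y^{**}=\mathrm{Lip}_0(M)$. A subspace $Z$ of a Banach space $X$, with annihilator $Z^\perp\subset X^*$, is an $M$-ideal in $X$ if there is a linear projection $P$ on $X^*$ with $\ker P=Z^\perp$ and $\|x^*\|=\|Px^*\|+\|x^*-Px^*\|$ for all $x^*\in X^*$. A Banach space $X$ is $M$-embedded if (its canonical image) is an $M$-ideal in $X^{**}$. *)

theory Defs
  imports "HOL-Analysis.Analysis" "HOL-Library.Function_Algebras"
begin

instantiation "fun" :: (type, real_vector) real_vector
begin

definition scaleR_fun :: "real \<Rightarrow> ('a \<Rightarrow> 'b) \<Rightarrow> 'a \<Rightarrow> 'b" where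
  "scaleR_fun c f = (\<lambda>x. c *\<^sub>R f x)"

instance
  by standard (simp_all add: scaleR_fun_def fun_eq_iff algebra_simps)

end

text \<open>
  The spaces \<open>Y\<close>, \<open>Y\<^sup>*\<close>, \<open>Y\<^sup>*\<^sup>*\<close>, \<open>Y\<^sup>*\<^sup>*\<^sup>*\<close> depend on term parameters, so a normed space is
  given by a linear subspace \<open>V\<close> of an ambient real vector space together with a function \<open>N\<close>
  whose restriction to \<open>V\<close> is the norm.
\<close>

locale normed_space_on =
  fixes V :: "'v::real_vector set" and N :: "'v \<Rightarrow> real"
  assumes subspace: "subspace V"
    and eq_zero_iff: "x \<in> V \<Longrightarrow> N x = 0 \<longleftrightarrow> x = 0"
    and triangle: "x \<in> V \<Longrightarrow> y \<in> V \<Longrightarrow> N (x + y) \<le> N x + N y"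
    and scaleR: "x \<in> V \<Longrightarrow> N (c *\<^sub>R x) = \<bar>c\<bar> * N x"

definition linear_map_on :: "'v::real_vector set \<Rightarrow> ('v \<Rightarrow> 'w::real_vector) \<Rightarrow> bool" where
  "linear_map_on V f \<longleftrightarrow>
     (\<forall>x\<in>V. \<forall>y\<in>V. f (x + y) = f x + f y) \<and> (\<forall>c. \<forall>x\<in>V. f (c *\<^sub>R x) = c *\<^sub>R f x)"

text \<open>
  A functional on \<open>V\<close> is represented by its extension by \<open>0\<close> outside \<open>V\<close>. This makes the
  representation unique and compatible with the pointwise vector space operations.
\<close>

definition dual :: "'v::real_vector set \<Rightarrow> ('v \<Rightarrow> real) \<Rightarrow> ('v \<Rightarrow> real) set" where
  "dual V N = {\<phi>. linear_map_on V \<phi> \<and> (\<exists>C. \<forall>x\<in>V. \<bar>\<phi> x\<bar> \<le> C * N x) \<and> (\<forall>x. x \<notin> V \<longrightarrow> \<phi> x = 0)}"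

definition dual_norm :: "'v::real_vector set \<Rightarrow> ('v \<Rightarrow> real) \<Rightarrow> ('v \<Rightarrow> real) \<Rightarrow> real" where
  "dual_norm V N \<phi> = (SUP x\<in>{x\<in>V. N x \<le> 1}. \<bar>\<phi> x\<bar>)"

definition bidual :: "'v::real_vector set \<Rightarrow> ('v \<Rightarrow> real) \<Rightarrow> (('v \<Rightarrow> real) \<Rightarrow> real) set" where
  "bidual V N = dual (dual V N) (dual_norm V N)"

definition bidual_norm :: "'v::real_vector set \<Rightarrow> ('v \<Rightarrow> real) \<Rightarrow> (('v \<Rightarrow> real) \<Rightarrow> real) \<Rightarrow> real" where
  "bidual_norm V N = dual_norm (dual V N) (dual_norm V N)"

definition canonical_embedding ::
    "'v::real_vector set \<Rightarrow> ('v \<Rightarrow> real) \<Rightarrow> 'v \<Rightarrow> ('v \<Rightarrow> real) \<Rightarrow> real" where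
  "canonical_embedding V N x = (\<lambda>\<phi>. if \<phi> \<in> dual V N then \<phi> x else 0)"

definition annihilator ::
    "'v::real_vector set \<Rightarrow> ('v \<Rightarrow> real) \<Rightarrow> 'v set \<Rightarrow> ('v \<Rightarrow> real) set" where
  "annihilator V N Z = {\<phi> \<in> dual V N. \<forall>z\<in>Z. \<phi> z = 0}"

definition M_ideal :: "'v::real_vector set \<Rightarrow> ('v \<Rightarrow> real) \<Rightarrow> 'v set \<Rightarrow> bool" where
  "M_ideal V N Z \<longleftrightarrow> subspace Z \<and> Z \<subseteq> V \<and>
     (\<exists>P. P ` dual V N \<subseteq> dual V N \<and> linear_map_on (dual V N) P \<and>
          (\<forall>\<phi>\<in>dual V N. P (P \<phi>) = P \<phi>) \<and>
          {\<phi> \<in> dual V N. P \<phi> = 0} = annihilator V N Z \<and>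
          (\<forall>\<phi>\<in>dual V N. dual_norm V N \<phi> = dual_norm V N (P \<phi>) + dual_norm V N (\<phi> - P \<phi>)))"

definition M_embedded :: "'v::real_vector set \<Rightarrow> ('v \<Rightarrow> real) \<Rightarrow> bool" where
  "M_embedded V N \<longleftrightarrow> M_ideal (bidual V N) (bidual_norm V N) (canonical_embedding V N ` V)"

definition ultrametric :: "'a::metric_space itself \<Rightarrow> bool" where
  "ultrametric _ \<longleftrightarrow> (\<forall>x y z :: 'a. dist x y \<le> max (dist x z) (dist z y))"

text \<open>
  Balls are taken closed. In an ultrametric space open balls give the same notion: between two
  distinct consecutive balls of one kind there is a ball of the other kind.
\<close>

definition spherically_complete :: "'a::metric_space itself \<Rightarrow> bool" where
  "spherically_complete _ \<longleftrightarrow>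
     (\<forall>(c :: nat \<Rightarrow> 'a) r. (\<forall>n. 0 < r n) \<and> decseq (\<lambda>n. cball (c n) (r n)) \<longrightarrow>
        (\<Inter>n. cball (c n) (r n)) \<noteq> {})"

definition proper_metric :: "'a::metric_space itself \<Rightarrow> bool" where
  "proper_metric _ \<longleftrightarrow> (\<forall>(x :: 'a) r. compact (cball x r))"

definition Lip0 :: "'a::metric_space \<Rightarrow> ('a \<Rightarrow> real) set" where
  "Lip0 z = {f. (\<exists>C. C-lipschitz_on UNIV f) \<and> f z = 0}"

definition lip_norm :: "('a::metric_space \<Rightarrow> real) \<Rightarrow> real" where
  "lip_norm f = Inf {C. C-lipschitz_on UNIV f}"

text \<open>
  Sequences are indexed from \<open>0\<close>, so \<open>nearest_index s n\<close> and \<open>retr s n\<close> below are the maps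
  \<open>i\<^sub>n\<^sub>+\<^sub>1\<close> (shifted by one) and \<open>r\<^sub>n\<^sub>+\<^sub>1\<close> belonging to the first \<open>n + 1\<close> terms of the sequence.
\<close>

definition nearest_index :: "(nat \<Rightarrow> 'a::metric_space) \<Rightarrow> nat \<Rightarrow> 'a \<Rightarrow> nat" where
  "nearest_index s n x = Min {k. k \<le> n \<and> Min ((\<lambda>j. dist x (s j)) ` {..n}) = dist x (s k)}"

definition retr :: "(nat \<Rightarrow> 'a::metric_space) \<Rightarrow> nat \<Rightarrow> 'a \<Rightarrow> 'a" where
  "retr s n x = s (nearest_index s n x)"

definition predual :: "'a::metric_space \<Rightarrow> (nat \<Rightarrow> 'a) \<Rightarrow> ('a \<Rightarrow> real) set" where
  "predual z s = {f \<in> Lip0 z. \<forall>\<epsilon>>0. \<exists>n. \<forall>x y. retr s n x = retr s n y \<longrightarrow>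
     \<bar>f x - f y\<bar> \<le> \<epsilon> * dist x y}"

text \<open>The pairs \<open>(V, N)\<close> used here are indeed normed spaces.\<close>

context normed_space_on
begin

lemma zero_mem: "0 \<in> V" and add_mem: "x \<in> V \<Longrightarrow> y \<in> V \<Longrightarrow> x + y \<in> V"
  and scaleR_mem: "x \<in> V \<Longrightarrow> c *\<^sub>R x \<in> V"
  using subspace by (auto simp: subspace_def)

lemma nonneg:
  assumes "x \<in> V" shows "0 \<le> N x"
proof -
  have "N (x + (-1) *\<^sub>R x) \<le> N x + N ((-1) *\<^sub>R x)"
    by (intro triangle scaleR_mem assms)
  then show ?thesis
    using scaleR[OF assms, of "-1"] eq_zero_iff[OF zero_mem] by simp
qed

lemma bdd_above_unit_ball:
  assumes "\<phi> \<in> dual V N"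
  shows "bdd_above ((\<lambda>x. \<bar>\<phi> x\<bar>) ` {x\<in>V. N x \<le> 1})"
proof -
  obtain C where C: "\<And>x. x \<in> V \<Longrightarrow> \<bar>\<phi> x\<bar> \<le> C * N x"
    using assms by (auto simp: dual_def)
  show ?thesis
  proof (rule bdd_aboveI2)
    fix x assume x: "x \<in> {x\<in>V. N x \<le> 1}"
    then have "\<bar>\<phi> x\<bar> \<le> C * N x" using C by auto
    also have "\<dots> \<le> \<bar>C\<bar> * 1"
      using x nonneg[of x] by (intro mult_mono) auto
    finally show "\<bar>\<phi> x\<bar> \<le> \<bar>C\<bar>" by simp
  qed
qed

lemma zero_unit_ball: "0 \<in> {x\<in>V. N x \<le> 1}"
  using zero_mem eq_zero_iff[OF zero_mem] by simp

lemma dual_norm_upper: "\<phi> \<in> dual V N \<Longrightarrow> x \<in> V \<Longrightarrow> N x \<le> 1 \<Longrightarrow> \<bar>\<phi> x\<bar> \<le> dual_norm V N \<phi>"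
  unfolding dual_norm_def by (rule cSUP_upper[OF _ bdd_above_unit_ball]) auto

lemma dual_norm_bound:
  assumes "\<phi> \<in> dual V N" "x \<in> V"
  shows "\<bar>\<phi> x\<bar> \<le> dual_norm V N \<phi> * N x"
proof (cases "N x = 0")
  case True
  have "\<phi> (0 *\<^sub>R x) = 0 *\<^sub>R \<phi> x"
    using assms unfolding dual_def linear_map_on_def by blast
  with True show ?thesis using eq_zero_iff[OF assms(2)] by simp
next
  case False
  then have pos: "N x > 0" using nonneg[OF assms(2)] by simp
  have "\<bar>\<phi> (inverse (N x) *\<^sub>R x)\<bar> \<le> dual_norm V N \<phi>"
    using pos by (intro dual_norm_upper assms scaleR_mem) (simp add: scaleR[OF assms(2)])
  moreover have "\<phi> (inverse (N x) *\<^sub>R x) = inverse (N x) * \<phi> x"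
    using assms by (auto simp: dual_def linear_map_on_def)
  ultimately have "\<bar>\<phi> x\<bar> / N x \<le> dual_norm V N \<phi>"
    using pos by (simp add: abs_mult divide_inverse mult.commute)
  then show ?thesis using pos by (simp add: divide_le_eq)
qed

lemma dual_normed_space: "normed_space_on (dual V N) (dual_norm V N)"
proof
  show "subspace (dual V N)"
  proof (rule subspaceI)
    show "0 \<in> dual V N"
      by (auto simp: dual_def linear_map_on_def intro!: exI[of _ 0])
  next
    fix \<phi> \<psi> assume *: "\<phi> \<in> dual V N" "\<psi> \<in> dual V N"
    have "\<bar>(\<phi> + \<psi>) x\<bar> \<le> (dual_norm V N \<phi> + dual_norm V N \<psi>) * N x" if "x \<in> V" for x
      using dual_norm_bound[OF *(1) that] dual_norm_bound[OF *(2) that]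
      by (simp add: distrib_right)
    with * show "\<phi> + \<psi> \<in> dual V N"
      by (auto simp: dual_def linear_map_on_def distrib_left)
  next
    fix c :: real and \<phi> assume *: "\<phi> \<in> dual V N"
    have "\<bar>(c *\<^sub>R \<phi>) x\<bar> \<le> (\<bar>c\<bar> * dual_norm V N \<phi>) * N x" if "x \<in> V" for x
      using mult_left_mono[OF dual_norm_bound[OF * that], of "\<bar>c\<bar>"]
      by (simp add: scaleR_fun_def abs_mult mult.assoc)
    with * show "c *\<^sub>R \<phi> \<in> dual V N"
      by (auto simp: dual_def linear_map_on_def scaleR_fun_def distrib_left)
  qed
  note sub = this
  fix \<phi> assume \<phi>: "\<phi> \<in> dual V N"
  show "dual_norm V N \<phi> = 0 \<longleftrightarrow> \<phi> = 0"
  proof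
    assume "dual_norm V N \<phi> = 0"
    then have "\<phi> x = 0" for x
      using dual_norm_bound[OF \<phi>, of x] \<phi> by (cases "x \<in> V") (auto simp: dual_def)
    then show "\<phi> = 0" by (simp add: fun_eq_iff)
  next
    assume "\<phi> = 0"
    moreover have "{x\<in>V. N x \<le> 1} \<noteq> {}" using zero_unit_ball by blast
    ultimately show "dual_norm V N \<phi> = 0" by (simp add: dual_norm_def)
  qed
  show "dual_norm V N (\<phi> + \<psi>) \<le> dual_norm V N \<phi> + dual_norm V N \<psi>"
    if \<psi>: "\<psi> \<in> dual V N" for \<psi>
    unfolding dual_norm_def[of V N "\<phi> + \<psi>"]
  proof (rule cSUP_least)
    fix x assume "x \<in> {x\<in>V. N x \<le> 1}"
    then show "\<bar>(\<phi> + \<psi>) x\<bar> \<le> dual_norm V N \<phi> + dual_norm V N \<psi>"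
      using dual_norm_upper[OF \<phi>, of x] dual_norm_upper[OF \<psi>, of x] by simp
  qed (use zero_unit_ball in blast)
  have le: "dual_norm V N (c *\<^sub>R \<psi>) \<le> \<bar>c\<bar> * dual_norm V N \<psi>" if \<psi>: "\<psi> \<in> dual V N" for c \<psi>
    unfolding dual_norm_def[of V N "c *\<^sub>R \<psi>"]
  proof (rule cSUP_least)
    fix x assume "x \<in> {x\<in>V. N x \<le> 1}"
    then show "\<bar>(c *\<^sub>R \<psi>) x\<bar> \<le> \<bar>c\<bar> * dual_norm V N \<psi>"
      using dual_norm_upper[OF \<psi>, of x]
      by (auto simp: scaleR_fun_def abs_mult intro: mult_left_mono)
  qed (use zero_unit_ball in blast)
  show "dual_norm V N (c *\<^sub>R \<phi>) = \<bar>c\<bar> * dual_norm V N \<phi>" for c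
  proof (rule antisym[OF le[OF \<phi>]])
    show "\<bar>c\<bar> * dual_norm V N \<phi> \<le> dual_norm V N (c *\<^sub>R \<phi>)"
    proof (cases "c = 0")
      case True
      have "\<bar>(c *\<^sub>R \<phi>) 0\<bar> \<le> dual_norm V N (c *\<^sub>R \<phi>)"
        using zero_unit_ball
        by (intro dual_norm_upper subspace_scale[OF sub] \<phi>) auto
      with True show ?thesis by simp
    next
      case False
      have "dual_norm V N (inverse c *\<^sub>R (c *\<^sub>R \<phi>)) \<le> \<bar>inverse c\<bar> * dual_norm V N (c *\<^sub>R \<phi>)"
        by (intro le subspace_scale[OF sub] \<phi>)
      with False show ?thesis by (simp add: field_simps)
    qed
  qed
qed

end

lemma lip_norm_lipschitz:
  assumes "C-lipschitz_on UNIV f"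
  shows "(lip_norm f)-lipschitz_on UNIV f"
proof (rule lipschitz_onI)
  have ne: "{C. C-lipschitz_on UNIV f} \<noteq> {}" using assms by blast
  show "0 \<le> lip_norm f"
    unfolding lip_norm_def by (rule cInf_greatest[OF ne]) (auto dest: lipschitz_on_nonneg)
  fix x y
  show "dist (f x) (f y) \<le> lip_norm f * dist x y"
  proof (cases "x = y")
    case False
    have "dist (f x) (f y) / dist x y \<le> lip_norm f"
      unfolding lip_norm_def
    proof (rule cInf_greatest[OF ne])
      fix C assume "C \<in> {C. C-lipschitz_on UNIV f}"
      then have "dist (f x) (f y) \<le> C * dist x y" by (auto dest: lipschitz_onD)
      with False show "dist (f x) (f y) / dist x y \<le> C" by (simp add: divide_le_eq)
    qed
    with False show ?thesis by (simp add: divide_le_eq)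
  qed simp
qed

lemma lip_norm_le:
  assumes "C-lipschitz_on UNIV f" shows "lip_norm f \<le> C"
  unfolding lip_norm_def using assms
  by (intro cInf_lower bdd_belowI[of _ 0]) (auto dest: lipschitz_on_nonneg)

lemma Lip0_normed_space: "normed_space_on (Lip0 z) lip_norm"
proof
  have add: "(C + D)-lipschitz_on UNIV (f + g)"
    if "C-lipschitz_on UNIV f" "D-lipschitz_on UNIV g" for C D and f g :: "'a \<Rightarrow> real"
    using lipschitz_on_add[OF that] by (simp add: plus_fun_def)
  have scale: "(\<bar>c\<bar> * C)-lipschitz_on UNIV (c *\<^sub>R f)"
    if "C-lipschitz_on UNIV f" for C c and f :: "'a \<Rightarrow> real"
    using lipschitz_on_cmult_real[OF that, of c] by (simp add: scaleR_fun_def)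
  show sub: "subspace (Lip0 z)"
  proof (rule subspaceI)
    show "0 \<in> Lip0 z" by (auto simp: Lip0_def lipschitz_on_def intro!: exI[of _ 0])
  next
    fix f g assume "f \<in> Lip0 z" "g \<in> Lip0 z"
    then show "f + g \<in> Lip0 z" using add by (fastforce simp: Lip0_def)
  next
    fix c f assume "f \<in> Lip0 z"
    then show "c *\<^sub>R f \<in> Lip0 z"
      using scale by (fastforce simp: Lip0_def scaleR_fun_def)
  qed
  fix f assume f: "f \<in> Lip0 z"
  then have fl: "(lip_norm f)-lipschitz_on UNIV f" by (auto simp: Lip0_def lip_norm_lipschitz)
  show "lip_norm f = 0 \<longleftrightarrow> f = 0"
  proof
    assume "lip_norm f = 0"
    then have "f x = f z" for x using lipschitz_onD[OF fl, of x z] by simp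
    then show "f = 0" using f by (simp add: Lip0_def fun_eq_iff)
  next
    assume "f = 0"
    then have "0-lipschitz_on UNIV f" by (simp add: lipschitz_on_def)
    then show "lip_norm f = 0" using lip_norm_le lipschitz_on_nonneg[OF fl] by fastforce
  qed
  show "lip_norm (f + g) \<le> lip_norm f + lip_norm g" if "g \<in> Lip0 z" for g
    using that by (intro lip_norm_le add fl) (auto simp: Lip0_def lip_norm_lipschitz)
  show "lip_norm (c *\<^sub>R f) = \<bar>c\<bar> * lip_norm f" for c
  proof (rule antisym)
    show "lip_norm (c *\<^sub>R f) \<le> \<bar>c\<bar> * lip_norm f" by (intro lip_norm_le scale fl)
    have cf: "(lip_norm (c *\<^sub>R f))-lipschitz_on UNIV (c *\<^sub>R f)"
      using scale[OF fl] by (rule lip_norm_lipschitz)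
    show "\<bar>c\<bar> * lip_norm f \<le> lip_norm (c *\<^sub>R f)"
    proof (cases "c = 0")
      case True
      then show ?thesis using lipschitz_on_nonneg[OF cf] by simp
    next
      case False
      have "lip_norm (inverse c *\<^sub>R (c *\<^sub>R f)) \<le> \<bar>inverse c\<bar> * lip_norm (c *\<^sub>R f)"
        by (intro lip_norm_le scale cf)
      with False show ?thesis by (simp add: field_simps)
    qed
  qed
qed

lemma nearest_index_spec:
  fixes s :: "nat \<Rightarrow> 'a::metric_space" and n x
  defines "k \<equiv> nearest_index s n x"
  shows "k \<le> n" "j \<le> n \<Longrightarrow> dist x (s k) \<le> dist x (s j)" "j < k \<Longrightarrow> dist x (s k) < dist x (s j)"
proof -
  define m where "m = Min ((\<lambda>j. dist x (s j)) ` {..n})"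
  define K where "K = {k. k \<le> n \<and> m = dist x (s k)}"
  have "m \<in> (\<lambda>j. dist x (s j)) ` {..n}" unfolding m_def by (rule Min_in) auto
  then have "K \<noteq> {}" by (auto simp: K_def)
  moreover have fin: "finite K" by (simp add: K_def)
  moreover have k: "k = Min K" by (simp add: k_def nearest_index_def K_def m_def)
  ultimately have "k \<in> K" by simp
  then have kn: "k \<le> n" and km: "m = dist x (s k)" by (auto simp: K_def)
  show "k \<le> n" by (rule kn)
  show le: "dist x (s k) \<le> dist x (s j)" if "j \<le> n" for j
    using that unfolding km[symmetric] m_def by (intro Min_le) auto
  show "dist x (s k) < dist x (s j)" if "j < k"
  proof -
    have "j \<notin> K" using that fin k by (metis Min_le leD)
    with that kn have "dist x (s j) \<noteq> dist x (s k)" by (auto simp: K_def km)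
    with le[of j] that kn show ?thesis by simp
  qed
qed

lemma nearest_index_eqI:
  assumes "k \<le> n" "\<And>j. j \<le> n \<Longrightarrow> dist x (s k) \<le> dist x (s j)"
    "\<And>j. j < k \<Longrightarrow> dist x (s k) < dist x (s j)"
  shows "nearest_index s n x = k"
proof (rule ccontr)
  assume "nearest_index s n x \<noteq> k"
  then consider "nearest_index s n x < k" | "k < nearest_index s n x" by linarith
  then show False
  proof cases
    case 1
    then show False
      using assms(3)[OF 1] nearest_index_spec(2)[OF assms(1), of x s] by linarith
  next
    case 2
    then show False
      using nearest_index_spec(3)[OF 2] assms(2)[OF nearest_index_spec(1)[of s n x]] by linarith
  qed
qed

lemma retr_retr:
  fixes s :: "nat \<Rightarrow> 'a::metric_space"
  assumes um: "ultrametric TYPE('a)" and "n \<le> m"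
  shows "retr s n (retr s m x) = retr s n x"
proof -
  define k where "k = nearest_index s m x"
  define i where "i = nearest_index s n x"
  note ks = nearest_index_spec[where s=s and n=m and x=x, folded k_def]
  note iss = nearest_index_spec[where s=s and n=n and x=x, folded i_def]
  have "nearest_index s n (s k) = i"
  proof (cases "k \<le> n")
    case True
    have "i = k" unfolding i_def using ks True \<open>n \<le> m\<close> by (intro nearest_index_eqI) auto
    moreover have "0 < dist (s k) (s j)" if "j < k" for j using ks(3)[OF that] by auto
    ultimately show ?thesis using True by (intro nearest_index_eqI) (auto simp del: zero_less_dist_iff)
  next
    case False
    have "dist (s k) (s j) = dist x (s j)" if "j \<le> n" for j
    proof -
      have "dist x (s k) < dist x (s j)" using that False by (intro ks) auto
      moreover have "dist (s k) (s j) \<le> max (dist (s k) x) (dist x (s j))"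
        "dist x (s j) \<le> max (dist x (s k)) (dist (s k) (s j))"
        using um unfolding ultrametric_def by blast+
      ultimately show ?thesis by (auto simp: dist_commute max_def split: if_splits)
    qed
    then show ?thesis using iss by (intro nearest_index_eqI) auto
  qed
  then show ?thesis by (simp add: retr_def k_def i_def)
qed

lemma predual_normed_space:
  fixes s :: "nat \<Rightarrow> 'a::metric_space"
  assumes um: "ultrametric TYPE('a)"
  shows "normed_space_on (predual z s) lip_norm"
proof -
  interpret L: normed_space_on "Lip0 z" lip_norm by (rule Lip0_normed_space)
  have "subspace (predual z s)"
  proof (rule subspaceI)
    show "0 \<in> predual z s" using L.zero_mem by (auto simp: predual_def)
  next
    fix f g assume f: "f \<in> predual z s" and g: "g \<in> predual z s"
    have "\<exists>n. \<forall>x y. retr s n x = retr s n y \<longrightarrow> \<bar>(f + g) x - (f + g) y\<bar> \<le> \<epsilon> * dist x y"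
      if "\<epsilon> > 0" for \<epsilon>
    proof -
      obtain n where n: "\<And>x y. retr s n x = retr s n y \<Longrightarrow> \<bar>f x - f y\<bar> \<le> \<epsilon> / 2 * dist x y"
        using f half_gt_zero[OF \<open>\<epsilon> > 0\<close>] unfolding predual_def by blast
      obtain m where m: "\<And>x y. retr s m x = retr s m y \<Longrightarrow> \<bar>g x - g y\<bar> \<le> \<epsilon> / 2 * dist x y"
        using g half_gt_zero[OF \<open>\<epsilon> > 0\<close>] unfolding predual_def by blast
      have "\<bar>(f + g) x - (f + g) y\<bar> \<le> \<epsilon> * dist x y"
        if "retr s (max n m) x = retr s (max n m) y" for x y
      proof -
        have "retr s n x = retr s n y" "retr s m x = retr s m y"
          using retr_retr[OF um, of n "max n m" s x] retr_retr[OF um, of n "max n m" s y]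
            retr_retr[OF um, of m "max n m" s x] retr_retr[OF um, of m "max n m" s y] that
          by simp_all
        then show ?thesis using n[of x y] m[of x y] by (simp add: abs_if split: if_splits)
      qed
      then show ?thesis by blast
    qed
    then show "f + g \<in> predual z s"
      using f g L.add_mem by (simp add: predual_def)
  next
    fix c :: real and f assume f: "f \<in> predual z s"
    have "\<exists>n. \<forall>x y. retr s n x = retr s n y \<longrightarrow> \<bar>(c *\<^sub>R f) x - (c *\<^sub>R f) y\<bar> \<le> \<epsilon> * dist x y"
      if "\<epsilon> > 0" for \<epsilon>
    proof -
      define \<delta> where "\<delta> = \<epsilon> / (\<bar>c\<bar> + 1)"
      have \<delta>: "\<delta> > 0" "\<bar>c\<bar> * \<delta> \<le> \<epsilon>" using that by (auto simp: \<delta>_def field_simps)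
      obtain n where n: "\<And>x y. retr s n x = retr s n y \<Longrightarrow> \<bar>f x - f y\<bar> \<le> \<delta> * dist x y"
        using f \<delta>(1) unfolding predual_def by blast
      have "\<bar>(c *\<^sub>R f) x - (c *\<^sub>R f) y\<bar> \<le> \<epsilon> * dist x y" if "retr s n x = retr s n y" for x y
      proof -
        have "\<bar>(c *\<^sub>R f) x - (c *\<^sub>R f) y\<bar> = \<bar>c\<bar> * \<bar>f x - f y\<bar>"
          by (simp add: scaleR_fun_def abs_mult flip: right_diff_distrib)
        also have "\<dots> \<le> \<bar>c\<bar> * (\<delta> * dist x y)" by (intro mult_left_mono n that) auto
        also have "\<dots> \<le> \<epsilon> * dist x y"
          using mult_right_mono[OF \<delta>(2), of "dist x y"] by (simp add: mult.assoc)
        finally show ?thesis .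
      qed
      then show ?thesis by blast
    qed
    then show "c *\<^sub>R f \<in> predual z s"
      using f L.scaleR_mem by (simp add: predual_def)
  qed
  moreover have "f \<in> Lip0 z" if "f \<in> predual z s" for f using that by (simp add: predual_def)
  ultimately show ?thesis
    by (intro normed_space_on.intro L.eq_zero_iff L.triangle L.scaleR)
qed

end

theory Submission
  imports Defs
begin

text \<open>
  Write \<open>Y\<close> for the predual, \<open>r\<^sub>n\<close> for \<open>retr s n\<close> and \<open>e\<^sub>x \<in> Y\<^sup>*\<close> for the evaluation at \<open>x\<close>.

  If \<open>M\<close> is proper, the projection on \<open>Y\<^sup>*\<^sup>*\<^sup>*\<close> is the Dixmier projection, which restricts a
  functional to \<open>Y\<close> and lets \<open>Y\<^sup>*\<^sup>*\<close> act on the restriction. It is additive for the norm as soon as for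
  every \<open>y\<close> in the unit ball of \<open>Y\<close> and every \<open>\<epsilon> > 0\<close> there is a finite rank operator \<open>R\<close> with
  \<open>\<parallel>y + g - R g\<parallel> \<le> 1 + \<epsilon>\<close> for all \<open>g\<close> in the unit ball (\<open>M_embeddedI\<close>): \<open>1 - R\<close> turns an
  element of \<open>Y\<^sup>*\<^sup>*\<close> into one that can be added to \<open>y\<close> almost without increasing the norm, and that
  differs from the original only by an element of \<open>Y\<close>. A single operator \<open>g \<mapsto> g \<circ> r\<^sub>n\<close> is not
  good enough, since \<open>g - g \<circ> r\<^sub>n\<close> may have norm close to 2. But it is bad only for pairs of points at the scale
  of \<open>r\<^sub>n\<close>. The average of \<open>m\<close> such operators, with indices growing so fast that every pair is
  bad for at most one of them, loses only \<open>2 / m\<close> (\<open>averaged_remainder_bound\<close>). Compactness of balls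
  is what allows the next index to be chosen after the previous one.

  Conversely, if \<open>Y\<close> is M-embedded, then the norm of \<open>Y\<^sup>*\<^sup>*\<^sup>*\<close> is additive on the sum of \<open>Y\<^sup>*\<close> and the
  annihilator of \<open>Y\<close> (\<open>M_embedded_norm_add\<close>). If \<open>M\<close> is not proper, some bounded ultrafilter \<open>U\<close> on
  \<open>M\<close> does not converge. Spherical completeness yields a term \<open>a\<close> of the sequence such that, for all
  large \<open>n\<close>, \<open>r\<^sub>n\<close> is \<open>U\<close>-almost everywhere equal to \<open>a\<close> (\<open>stable_retraction\<close>). So \<open>e\<^sub>x\<close> tends to
  \<open>e\<^sub>a\<close> weak-star in \<open>Y\<^sup>*\<close> along \<open>U\<close>, while \<open>d(x, a)\<close> tends to some \<open>c > 0\<close>. The limit \<open>\<psi>\<close> of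
  \<open>e\<^sub>x - e\<^sub>a\<close>, taken in \<open>Y\<^sup>*\<^sup>*\<^sup>*\<close>, annihilates \<open>Y\<close> and has norm at least \<open>c\<close>. For another term \<open>b\<close>,
  additivity gives the norm of \<open>(e\<^sub>a - e\<^sub>b) + \<psi>\<close> as at least \<open>d(a, b) + c\<close>. But this functional is the
  limit of \<open>e\<^sub>x - e\<^sub>b\<close>, and \<open>d(x, b) \<le> max (d(x, a)) (d(a, b))\<close>, so its norm is at most
  \<open>max c (d(a, b))\<close>: a contradiction.
\<close>

section \<open>Duals and M-embedded spaces\<close>

lemma sum_fun_apply: "(\<Sum>i\<in>I. f i) x = (\<Sum>i\<in>I. f i x)" for f :: "'i \<Rightarrow> 'b \<Rightarrow> 'c::comm_monoid_add"
  by (induction I rule: infinite_finite_induct) auto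

context normed_space_on
begin

lemma dual_add: "\<phi> \<in> dual V N \<Longrightarrow> x \<in> V \<Longrightarrow> y \<in> V \<Longrightarrow> \<phi> (x + y) = \<phi> x + \<phi> y"
  and dual_scaleR: "\<phi> \<in> dual V N \<Longrightarrow> x \<in> V \<Longrightarrow> \<phi> (c *\<^sub>R x) = c * \<phi> x"
  by (auto simp: dual_def linear_map_on_def)

lemma dual_minus: "\<phi> \<in> dual V N \<Longrightarrow> x \<in> V \<Longrightarrow> \<phi> (- x) = - \<phi> x"
  using dual_scaleR[of \<phi> x "-1"] by simp

lemma dual_diff: "\<phi> \<in> dual V N \<Longrightarrow> x \<in> V \<Longrightarrow> y \<in> V \<Longrightarrow> \<phi> (x - y) = \<phi> x - \<phi> y"
  using dual_add[of \<phi> x "- y"] dual_minus[of \<phi> y] subspace_neg[OF subspace, of y] by simp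

lemma sum_mem: "(\<And>i. i \<in> I \<Longrightarrow> x i \<in> V) \<Longrightarrow> sum x I \<in> V"
  using subspace_sum[OF subspace] by blast

lemma dual_sum:
  assumes "\<phi> \<in> dual V N" "\<And>i. i \<in> I \<Longrightarrow> x i \<in> V"
  shows "\<phi> (sum x I) = (\<Sum>i\<in>I. \<phi> (x i))"
  using assms(2)
proof (induction I rule: infinite_finite_induct)
  case (insert i I)
  then show ?case using dual_add[OF assms(1), of "x i" "sum x I"] sum_mem[of I x] by simp
qed (use dual_scaleR[OF assms(1) zero_mem, of 0] in auto)

lemma diff_mem: "x \<in> V \<Longrightarrow> y \<in> V \<Longrightarrow> x - y \<in> V"
  by (rule subspace_diff[OF subspace])

lemma norm_minus: "x \<in> V \<Longrightarrow> N (- x) = N x"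
  using scaleR[of x "-1"] by simp

lemma dualI:
  assumes "\<And>x y. x \<in> V \<Longrightarrow> y \<in> V \<Longrightarrow> \<phi> (x + y) = \<phi> x + \<phi> y"
    and "\<And>c x. x \<in> V \<Longrightarrow> \<phi> (c *\<^sub>R x) = c * \<phi> x"
    and "\<And>x. x \<in> V \<Longrightarrow> \<bar>\<phi> x\<bar> \<le> C * N x"
    and "\<And>x. x \<notin> V \<Longrightarrow> \<phi> x = 0"
  shows "\<phi> \<in> dual V N"
  unfolding dual_def linear_map_on_def using assms by (auto intro!: exI[of _ C])

lemma dual_norm_least:
  assumes "\<And>x. x \<in> V \<Longrightarrow> N x \<le> 1 \<Longrightarrow> \<bar>\<phi> x\<bar> \<le> c"
  shows "dual_norm V N \<phi> \<le> c"
  unfolding dual_norm_def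
  by (rule cSUP_least) (use zero_unit_ball assms in blast)+

lemma dual_norm_le:
  assumes "\<And>x. x \<in> V \<Longrightarrow> \<bar>\<phi> x\<bar> \<le> c * N x" "0 \<le> c"
  shows "dual_norm V N \<phi> \<le> c"
proof (rule dual_norm_least)
  fix x assume "x \<in> V" "N x \<le> 1"
  then show "\<bar>\<phi> x\<bar> \<le> c" using assms(1)[of x] mult_left_mono[of "N x" 1 c] assms(2) by simp
qed

lemma dual_norm_approx:
  assumes \<phi>: "\<phi> \<in> dual V N" and "\<epsilon> > 0"
  obtains x where "x \<in> V" "N x \<le> 1" "dual_norm V N \<phi> - \<epsilon> < \<phi> x"
proof -
  have "\<exists>x\<in>{x\<in>V. N x \<le> 1}. dual_norm V N \<phi> - \<epsilon> < \<bar>\<phi> x\<bar>"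
    using less_cSUP_iff[OF _ bdd_above_unit_ball[OF \<phi>], of "dual_norm V N \<phi> - \<epsilon>"]
      zero_unit_ball \<open>\<epsilon> > 0\<close> unfolding dual_norm_def by fastforce
  then obtain x where x: "x \<in> V" "N x \<le> 1" "dual_norm V N \<phi> - \<epsilon> < \<bar>\<phi> x\<bar>" by blast
  show thesis
  proof (cases "\<phi> x \<ge> 0")
    case False
    with x dual_minus[OF \<phi>, of x] show thesis
      by (intro that[of "- x"]) (auto simp: norm_minus subspace_neg[OF subspace])
  qed (use x that in auto)
qed

lemma canonical_embedding_in_bidual: "x \<in> V \<Longrightarrow> canonical_embedding V N x \<in> bidual V N"
  and canonical_embedding_norm_le: "x \<in> V \<Longrightarrow> bidual_norm V N (canonical_embedding V N x) \<le> N x"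
proof -
  interpret D: normed_space_on "dual V N" "dual_norm V N" by (rule dual_normed_space)
  assume x: "x \<in> V"
  have b: "\<bar>canonical_embedding V N x \<phi>\<bar> \<le> N x * dual_norm V N \<phi>" if "\<phi> \<in> dual V N" for \<phi>
    using dual_norm_bound[OF that x] that by (simp add: canonical_embedding_def mult.commute)
  show "canonical_embedding V N x \<in> bidual V N"
    unfolding bidual_def
    by (rule D.dualI[OF _ _ b])
      (auto simp: canonical_embedding_def D.add_mem D.scaleR_mem, simp add: scaleR_fun_def)
  show "bidual_norm V N (canonical_embedding V N x) \<le> N x"
    unfolding bidual_norm_def by (rule D.dual_norm_le[OF b nonneg[OF x]])
qed

lemma canonical_embedding_add:
    "x \<in> V \<Longrightarrow> y \<in> V \<Longrightarrow> canonical_embedding V N (x + y) = canonical_embedding V N x + canonical_embedding V N y"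
  and canonical_embedding_scaleR:
    "x \<in> V \<Longrightarrow> canonical_embedding V N (c *\<^sub>R x) = c *\<^sub>R canonical_embedding V N x"
  by (auto simp: canonical_embedding_def fun_eq_iff scaleR_fun_def dual_add dual_scaleR)

lemma canonical_embedding_subspace: "subspace (canonical_embedding V N ` V)"
proof (rule subspaceI)
  show "0 \<in> canonical_embedding V N ` V"
    using canonical_embedding_scaleR[OF zero_mem, of 0] zero_mem by force
qed (auto simp flip: canonical_embedding_add canonical_embedding_scaleR intro: add_mem scaleR_mem)

lemma bidual_normed_space: "normed_space_on (bidual V N) (bidual_norm V N)"
  unfolding bidual_def bidual_norm_def
  by (rule normed_space_on.dual_normed_space[OF dual_normed_space])

text \<open>The adjoint of the canonical embedding.\<close>

definition bidual_restrict :: "((('v \<Rightarrow> real) \<Rightarrow> real) \<Rightarrow> real) \<Rightarrow> 'v \<Rightarrow> real" where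
  "bidual_restrict \<Phi> x = (if x \<in> V then \<Phi> (canonical_embedding V N x) else 0)"

lemma bidual_restrict_in_dual:
  assumes "\<Phi> \<in> dual (bidual V N) (bidual_norm V N)"
  shows "bidual_restrict \<Phi> \<in> dual V N"
proof -
  interpret B: normed_space_on "bidual V N" "bidual_norm V N" by (rule bidual_normed_space)
  interpret T: normed_space_on "dual (bidual V N) (bidual_norm V N)" "dual_norm (bidual V N) (bidual_norm V N)"
    by (rule B.dual_normed_space)
  show ?thesis
  proof (rule dualI)
    fix x assume x: "x \<in> V"
    have "\<bar>\<Phi> (canonical_embedding V N x)\<bar>
        \<le> dual_norm (bidual V N) (bidual_norm V N) \<Phi> * bidual_norm V N (canonical_embedding V N x)"
      by (intro B.dual_norm_bound assms canonical_embedding_in_bidual x)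
    also have "\<dots> \<le> dual_norm (bidual V N) (bidual_norm V N) \<Phi> * N x"
      by (intro mult_left_mono canonical_embedding_norm_le x T.nonneg assms)
    finally show "\<bar>bidual_restrict \<Phi> x\<bar> \<le> dual_norm (bidual V N) (bidual_norm V N) \<Phi> * N x"
      using x by (simp add: bidual_restrict_def)
  qed (auto simp: bidual_restrict_def add_mem scaleR_mem canonical_embedding_add
      canonical_embedding_scaleR B.dual_add[OF assms] B.dual_scaleR[OF assms] canonical_embedding_in_bidual)
qed

text \<open>
  The projection of the third dual onto the canonical image of the dual, with the annihilator of
  the space as its kernel.
\<close>

definition dixmier where
  "dixmier \<Phi> = canonical_embedding (dual V N) (dual_norm V N) (bidual_restrict \<Phi>)"

lemma bidual_eq_dual_dual: "dual (dual V N) (dual_norm V N) = bidual V N"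
  "dual_norm (dual V N) (dual_norm V N) = bidual_norm V N"
  "bidual (dual V N) (dual_norm V N) = dual (bidual V N) (bidual_norm V N)"
  "bidual_norm (dual V N) (dual_norm V N) = dual_norm (bidual V N) (bidual_norm V N)"
  by (simp_all add: bidual_def bidual_norm_def)

lemma dixmier_apply: "F \<in> bidual V N \<Longrightarrow> dixmier \<Phi> F = F (bidual_restrict \<Phi>)"
  by (simp add: dixmier_def canonical_embedding_def bidual_eq_dual_dual)

text \<open>
  Kernel and idempotence of the Dixmier projection are formal; the content is the reverse triangle
  inequality. Let \<open>\<mu>\<close> be the restriction of \<open>\<Phi>\<close>, let \<open>y\<close> almost norm \<open>\<mu>\<close>, and let \<open>G\<close> in the bidual
  almost norm \<open>\<Phi> - dixmier \<Phi>\<close>. With \<open>R\<close> chosen for \<open>y\<close>, the test element \<open>H = y + G - R\<^sup>*\<^sup>*G\<close> has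
  norm at most \<open>1 + \<epsilon>\<close>, by dualising the hypothesis. As \<open>R\<close> has finite rank, \<open>R\<^sup>*\<^sup>*G\<close> lies in the space, so \<open>\<Phi>\<close> acts on it
  through \<open>\<mu>\<close>. The resulting error \<open>G (\<mu> - R\<^sup>*\<mu>)\<close> is small by the hypothesis again: since \<open>y\<close> almost
  norms \<open>\<mu>\<close>, there is no room left for \<open>\<mu> - R\<^sup>*\<mu>\<close>.
\<close>

theorem M_embeddedI:
  assumes approx: "\<And>y \<epsilon>. y \<in> V \<Longrightarrow> N y \<le> 1 \<Longrightarrow> \<epsilon> > 0 \<Longrightarrow>
      \<exists>(I :: 'i set) e v. finite I \<and> (\<forall>i\<in>I. e i \<in> dual V N \<and> v i \<in> V) \<and>
        (\<forall>g\<in>V. N g \<le> 1 \<longrightarrow> N (y + (g - (\<Sum>i\<in>I. e i g *\<^sub>R v i))) \<le> 1 + \<epsilon>)"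
  shows "M_embedded V N"
proof -
  interpret D: normed_space_on "dual V N" "dual_norm V N" by (rule dual_normed_space)
  interpret B: normed_space_on "bidual V N" "bidual_norm V N" by (rule bidual_normed_space)
  let ?T = "dual (bidual V N) (bidual_norm V N)" and ?n = "dual_norm (bidual V N) (bidual_norm V N)"
  interpret T: normed_space_on ?T ?n by (rule B.dual_normed_space)
  note emb = canonical_embedding_in_bidual
  have dix_mem: "dixmier \<Phi> \<in> ?T" if "\<Phi> \<in> ?T" for \<Phi>
    using D.canonical_embedding_in_bidual[OF bidual_restrict_in_dual[OF that]]
    by (simp add: dixmier_def bidual_eq_dual_dual)
  have dix_norm: "?n (dixmier \<Phi>) \<le> dual_norm V N (bidual_restrict \<Phi>)" if "\<Phi> \<in> ?T" for \<Phi>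
    using D.canonical_embedding_norm_le[OF bidual_restrict_in_dual[OF that]]
    by (simp add: dixmier_def bidual_eq_dual_dual)
  have dix_emb: "dixmier \<Phi> (canonical_embedding V N x) = \<Phi> (canonical_embedding V N x)"
    if "\<Phi> \<in> ?T" "x \<in> V" for \<Phi> x
    using bidual_restrict_in_dual[OF that(1)] that(2)
    by (simp add: dixmier_apply emb) (simp add: canonical_embedding_def bidual_restrict_def)
  have dix_zero: "dixmier \<Phi> = 0 \<longleftrightarrow> (\<forall>x\<in>V. \<Phi> (canonical_embedding V N x) = 0)"
    if \<Phi>: "\<Phi> \<in> ?T" for \<Phi>
  proof
    assume "dixmier \<Phi> = 0" then show "\<forall>x\<in>V. \<Phi> (canonical_embedding V N x) = 0"
      using dix_emb[OF \<Phi>] by simp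
  next
    assume "\<forall>x\<in>V. \<Phi> (canonical_embedding V N x) = 0"
    then have "bidual_restrict \<Phi> = 0" by (auto simp: bidual_restrict_def)
    then show "dixmier \<Phi> = 0"
      using D.canonical_embedding_scaleR[OF D.zero_mem, of 0] by (simp add: dixmier_def)
  qed
  have restrict_lin: "bidual_restrict (\<Phi> + \<Psi>) = bidual_restrict \<Phi> + bidual_restrict \<Psi>"
    "bidual_restrict (c *\<^sub>R \<Phi>) = c *\<^sub>R bidual_restrict \<Phi>" for \<Phi> \<Psi> c
    by (auto simp: bidual_restrict_def scaleR_fun_def)
  have lin: "linear_map_on ?T dixmier"
    unfolding linear_map_on_def dixmier_def
    by (auto simp: restrict_lin D.canonical_embedding_add D.canonical_embedding_scaleR
        bidual_restrict_in_dual)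
  have L: "?n \<Phi> = ?n (dixmier \<Phi>) + ?n (\<Phi> - dixmier \<Phi>)" if \<Phi>: "\<Phi> \<in> ?T" for \<Phi>
  proof (rule antisym)
    show "?n \<Phi> \<le> ?n (dixmier \<Phi>) + ?n (\<Phi> - dixmier \<Phi>)"
      using T.triangle[OF dix_mem[OF \<Phi>] T.diff_mem[OF \<Phi> dix_mem[OF \<Phi>]]] by simp
    define \<mu> where "\<mu> = bidual_restrict \<Phi>"
    have \<mu>: "\<mu> \<in> dual V N" unfolding \<mu>_def by (rule bidual_restrict_in_dual[OF \<Phi>])
    have key: "dual_norm V N \<mu> + ?n (\<Phi> - dixmier \<Phi>) \<le> ?n \<Phi> + \<epsilon> * (3 + dual_norm V N \<mu> + ?n \<Phi>)"
      if "\<epsilon> > 0" for \<epsilon>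
    proof -
      obtain y where y: "y \<in> V" "N y \<le> 1" and \<mu>y: "dual_norm V N \<mu> - \<epsilon> < \<mu> y"
        using dual_norm_approx[OF \<mu> \<open>\<epsilon> > 0\<close>] .
      obtain G where G: "G \<in> bidual V N" "bidual_norm V N G \<le> 1"
        and \<Phi>G: "?n (\<Phi> - dixmier \<Phi>) - \<epsilon> < (\<Phi> - dixmier \<Phi>) G"
        using B.dual_norm_approx[OF T.diff_mem[OF \<Phi> dix_mem[OF \<Phi>]] \<open>\<epsilon> > 0\<close>] .
      have G': "G \<in> dual (dual V N) (dual_norm V N)" using G(1) by (simp add: bidual_def)
      obtain I :: "'i set" and e v where I: "finite I" and ev: "\<And>i. i \<in> I \<Longrightarrow> e i \<in> dual V N" "\<And>i. i \<in> I \<Longrightarrow> v i \<in> V"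
        and R: "\<And>g. g \<in> V \<Longrightarrow> N g \<le> 1 \<Longrightarrow> N (y + (g - (\<Sum>i\<in>I. e i g *\<^sub>R v i))) \<le> 1 + \<epsilon>"
        using approx[OF y \<open>\<epsilon> > 0\<close>] by blast
      define R where "R g = (\<Sum>i\<in>I. e i g *\<^sub>R v i)" for g
      have Rmem: "R g \<in> V" for g unfolding R_def by (intro sum_mem scaleR_mem ev)
      \<comment> \<open>the adjoint of \<open>R\<close>\<close>
      define A where "A \<nu> = (\<Sum>i\<in>I. \<nu> (v i) *\<^sub>R e i)" for \<nu> :: "'v \<Rightarrow> real"
      have Amem: "A \<nu> \<in> dual V N" for \<nu> unfolding A_def by (intro D.sum_mem D.scaleR_mem ev)
      have Aapp: "A \<nu> g = \<nu> (R g)" if "\<nu> \<in> dual V N" for \<nu> g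
        unfolding R_def using dual_sum[OF that, of I "\<lambda>i. e i g *\<^sub>R v i"] ev scaleR_mem
        by (simp add: A_def sum_fun_apply scaleR_fun_def dual_scaleR[OF that] mult.commute)
      \<comment> \<open>the hypothesis on \<open>R\<close>, dualised\<close>
      have adj: "\<bar>\<nu> y\<bar> + dual_norm V N (\<nu> - A \<nu>) \<le> (1 + \<epsilon>) * dual_norm V N \<nu>" if \<nu>: "\<nu> \<in> dual V N" for \<nu>
      proof -
        have pos: "\<nu> y' + dual_norm V N (\<nu> - A \<nu>) \<le> (1 + \<epsilon>) * dual_norm V N \<nu>"
          if y': "y' \<in> V" "\<And>g. g \<in> V \<Longrightarrow> N g \<le> 1 \<Longrightarrow> N (y' + (g - R g)) \<le> 1 + \<epsilon>" for y'
        proof -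
          have "dual_norm V N (\<nu> - A \<nu>) \<le> (1 + \<epsilon>) * dual_norm V N \<nu> - \<nu> y'"
          proof (rule dual_norm_least)
            have *: "(\<nu> - A \<nu>) g \<le> (1 + \<epsilon>) * dual_norm V N \<nu> - \<nu> y'" if g: "g \<in> V" "N g \<le> 1" for g
            proof -
              have "\<nu> y' + (\<nu> - A \<nu>) g = \<nu> (y' + (g - R g))"
                using \<nu> y' g by (simp add: Aapp dual_add dual_diff Rmem diff_mem)
              also have "\<dots> \<le> dual_norm V N \<nu> * N (y' + (g - R g))"
                using dual_norm_bound[OF \<nu>, of "y' + (g - R g)"] y' g by (simp add: add_mem diff_mem Rmem)
              also have "\<dots> \<le> dual_norm V N \<nu> * (1 + \<epsilon>)"
                by (intro mult_left_mono y' g D.nonneg \<nu>)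
              finally show ?thesis by (simp add: mult.commute)
            qed
            fix g assume g: "g \<in> V" "N g \<le> 1"
            have "(\<nu> - A \<nu>) (- g) = - (\<nu> - A \<nu>) g"
              using dual_minus[OF D.diff_mem[OF \<nu> Amem] g(1)] .
            then show "\<bar>(\<nu> - A \<nu>) g\<bar> \<le> (1 + \<epsilon>) * dual_norm V N \<nu> - \<nu> y'"
              using *[OF g] *[of "- g"] g by (auto simp: norm_minus subspace_neg[OF subspace])
          qed
          then show ?thesis by simp
        qed
        have "N (- y + (g - R g)) \<le> 1 + \<epsilon>" if g: "g \<in> V" "N g \<le> 1" for g
        proof -
          have "R (- g) = - R g"
            unfolding R_def by (simp add: dual_minus ev g(1) sum_negf cong: sum.cong)
          moreover have "N (y + (- g - R (- g))) \<le> 1 + \<epsilon>"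
            unfolding R_def using g by (intro R) (auto simp: norm_minus subspace_neg[OF subspace])
          moreover have "N (- (y + (- g + R g))) = N (y + (- g + R g))"
            by (intro norm_minus add_mem subspace_neg[OF subspace] y(1) g(1) Rmem)
          ultimately show ?thesis by (simp add: algebra_simps)
        qed
        with pos[OF subspace_neg[OF subspace y(1)]] pos[OF y(1)] R y(1) show ?thesis
          by (auto simp: dual_minus[OF \<nu>] R_def)
      qed
      \<comment> \<open>\<open>w\<close> represents the image of \<open>G\<close> under the second adjoint of \<open>R\<close>\<close>
      define w where "w = (\<Sum>i\<in>I. G (e i) *\<^sub>R v i)"
      have w: "w \<in> V" unfolding w_def by (intro sum_mem scaleR_mem ev)
      have Gw: "G (A \<nu>) = \<nu> w" if \<nu>: "\<nu> \<in> dual V N" for \<nu>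
      proof -
        have "G (A \<nu>) = (\<Sum>i\<in>I. G (\<nu> (v i) *\<^sub>R e i))"
          unfolding A_def by (rule D.dual_sum[OF G']) (intro D.scaleR_mem ev)
        also have "\<dots> = (\<Sum>i\<in>I. \<nu> (G (e i) *\<^sub>R v i))"
          by (intro sum.cong refl) (simp add: D.dual_scaleR[OF G'] dual_scaleR[OF \<nu>] ev mult.commute)
        also have "\<dots> = \<nu> w"
          unfolding w_def by (rule dual_sum[OF \<nu>, symmetric]) (intro scaleR_mem ev)
        finally show ?thesis .
      qed
      define H where "H = canonical_embedding V N y + (G - canonical_embedding V N w)"
      have H: "H \<in> bidual V N"
        unfolding H_def by (intro B.add_mem B.diff_mem emb y w G)
      have Gbound: "\<bar>G \<nu>\<bar> \<le> dual_norm V N \<nu>" if "\<nu> \<in> dual V N" for \<nu>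
        using D.dual_norm_bound[OF G' that] mult_right_mono[OF G(2) D.nonneg[OF that]]
        by (simp add: bidual_norm_def)
      have "bidual_norm V N H \<le> 1 + \<epsilon>"
        unfolding bidual_norm_def
      proof (rule D.dual_norm_le)
        fix \<nu> assume \<nu>: "\<nu> \<in> dual V N"
        have "H \<nu> = \<nu> y + G (\<nu> - A \<nu>)"
          using \<nu> by (simp add: H_def canonical_embedding_def D.dual_diff[OF G'] Amem Gw)
        then show "\<bar>H \<nu>\<bar> \<le> (1 + \<epsilon>) * dual_norm V N \<nu>"
          using adj[OF \<nu>] Gbound[OF D.diff_mem[OF \<nu> Amem[of \<nu>]]] by linarith
      qed (use \<open>\<epsilon> > 0\<close> in simp)
      then have "\<Phi> H \<le> ?n \<Phi> * (1 + \<epsilon>)"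
        using B.dual_norm_bound[OF \<Phi> H] mult_left_mono[OF _ T.nonneg[OF \<Phi>], of "bidual_norm V N H" "1 + \<epsilon>"]
        by linarith
      moreover have "\<Phi> H = \<mu> y + (\<Phi> - dixmier \<Phi>) G + G (\<mu> - A \<mu>)"
      proof -
        have "\<Phi> H = \<mu> y + (\<Phi> G - \<mu> w)"
          using y w G by (simp add: H_def \<mu>_def bidual_restrict_def B.dual_add[OF \<Phi>] B.dual_diff[OF \<Phi>] emb B.diff_mem)
        moreover have "G (\<mu> - A \<mu>) = G \<mu> - \<mu> w"
          by (simp add: D.dual_diff[OF G' \<mu> Amem] Gw[OF \<mu>])
        moreover have "dixmier \<Phi> G = G \<mu>" by (simp add: dixmier_apply[OF G(1)] \<mu>_def)
        ultimately show ?thesis by simp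
      qed
      moreover have "\<bar>G (\<mu> - A \<mu>)\<bar> \<le> \<epsilon> * dual_norm V N \<mu> + \<epsilon>"
        using Gbound[OF D.diff_mem[OF \<mu> Amem[of \<mu>]]] adj[OF \<mu>] \<mu>y by (simp add: algebra_simps)
      ultimately show ?thesis using \<mu>y \<Phi>G by (simp add: algebra_simps)
    qed
    have "dual_norm V N \<mu> + ?n (\<Phi> - dixmier \<Phi>) \<le> ?n \<Phi>"
    proof (rule field_le_epsilon)
      fix \<delta> :: real assume \<delta>: "\<delta> > 0"
      define K where "K = 3 + dual_norm V N \<mu> + ?n \<Phi>"
      have K: "K > 0" using D.nonneg[OF \<mu>] T.nonneg[OF \<Phi>] by (simp add: K_def)
      show "dual_norm V N \<mu> + ?n (\<Phi> - dixmier \<Phi>) \<le> ?n \<Phi> + \<delta>"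
        using key[of "\<delta> / K", folded K_def] K \<delta> by simp
    qed
    then show "?n (dixmier \<Phi>) + ?n (\<Phi> - dixmier \<Phi>) \<le> ?n \<Phi>"
      using dix_norm[OF \<Phi>] by (simp add: \<mu>_def)
  qed
  have idem: "dixmier (dixmier \<Phi>) = dixmier \<Phi>" if \<Phi>: "\<Phi> \<in> ?T" for \<Phi>
  proof -
    have "bidual_restrict (dixmier \<Phi>) = bidual_restrict \<Phi>"
      by (auto simp: bidual_restrict_def dix_emb[OF \<Phi>])
    then show ?thesis by (simp add: dixmier_def)
  qed
  show ?thesis
    unfolding M_embedded_def M_ideal_def
  proof (intro conjI exI[of _ dixmier] ballI)
    show "{\<Phi> \<in> ?T. dixmier \<Phi> = 0} = annihilator (bidual V N) (bidual_norm V N) (canonical_embedding V N ` V)"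
      by (auto simp: annihilator_def dix_zero)
    show "dixmier ` ?T \<subseteq> ?T" using dix_mem by blast
    show "canonical_embedding V N ` V \<subseteq> bidual V N" using emb by blast
  qed (fact canonical_embedding_subspace lin idem L)+
qed

text \<open>
  An L-projection \<open>P\<close> whose kernel is the annihilator must fix the canonical image of the dual: \<open>P \<tau>\<close> has
  the smallest norm among all extensions of its restriction to the space, and the canonical image of
  \<open>\<mu>\<close> is an extension of \<open>\<mu>\<close> with the same norm as \<open>\<mu>\<close>.
\<close>

theorem M_embedded_norm_add:
  assumes emb: "M_embedded V N" and \<mu>: "\<mu> \<in> dual V N"
    and \<psi>: "\<psi> \<in> annihilator (bidual V N) (bidual_norm V N) (canonical_embedding V N ` V)"
  shows "dual_norm (bidual V N) (bidual_norm V N) (canonical_embedding (dual V N) (dual_norm V N) \<mu> + \<psi>)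
    = dual_norm V N \<mu> + dual_norm (bidual V N) (bidual_norm V N) \<psi>"
proof -
  interpret D: normed_space_on "dual V N" "dual_norm V N" by (rule dual_normed_space)
  interpret B: normed_space_on "bidual V N" "bidual_norm V N" by (rule bidual_normed_space)
  let ?T = "dual (bidual V N) (bidual_norm V N)" and ?n = "dual_norm (bidual V N) (bidual_norm V N)"
  interpret T: normed_space_on ?T ?n by (rule B.dual_normed_space)
  obtain P where P: "P ` ?T \<subseteq> ?T" and P_lin: "linear_map_on ?T P"
    and P_idem: "\<forall>\<Phi>\<in>?T. P (P \<Phi>) = P \<Phi>"
    and P_ker: "{\<Phi> \<in> ?T. P \<Phi> = 0} = annihilator (bidual V N) (bidual_norm V N) (canonical_embedding V N ` V)"
    and P_norm: "\<forall>\<Phi>\<in>?T. ?n \<Phi> = ?n (P \<Phi>) + ?n (\<Phi> - P \<Phi>)"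
    using emb unfolding M_embedded_def M_ideal_def by (elim conjE exE)
  have P_mem: "P \<Phi> \<in> ?T" if "\<Phi> \<in> ?T" for \<Phi>
    using P that by (rule subsetD[OF _ imageI])
  have P_add: "P (\<Phi> + \<Psi>) = P \<Phi> + P \<Psi>" if "\<Phi> \<in> ?T" "\<Psi> \<in> ?T" for \<Phi> \<Psi>
    using P_lin that by (simp add: linear_map_on_def)
  have \<psi>T: "\<psi> \<in> ?T" and P\<psi>: "P \<psi> = 0" using \<psi> unfolding P_ker[symmetric] by simp_all
  define \<tau> where "\<tau> = canonical_embedding (dual V N) (dual_norm V N) \<mu>"
  have \<tau>: "\<tau> \<in> ?T" and \<tau>_le: "?n \<tau> \<le> dual_norm V N \<mu>"
    unfolding \<tau>_def
    using D.canonical_embedding_in_bidual[OF \<mu>] D.canonical_embedding_norm_le[OF \<mu>]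
    by (simp_all add: bidual_eq_dual_dual)
  note diff = T.diff_mem[OF \<tau> P_mem[OF \<tau>]]
  have "P (\<tau> - P \<tau>) = 0"
    using P_add[OF diff P_mem[OF \<tau>]] bspec[OF P_idem \<tau>] by simp
  then have "\<tau> - P \<tau> \<in> annihilator (bidual V N) (bidual_norm V N) (canonical_embedding V N ` V)"
    unfolding P_ker[symmetric] using diff by simp
  then have "P \<tau> (canonical_embedding V N x) = \<tau> (canonical_embedding V N x)" if "x \<in> V" for x
    using that by (simp add: annihilator_def)
  moreover have "\<tau> (canonical_embedding V N x) = \<mu> x" if "x \<in> V" for x
  proof -
    have "\<tau> (canonical_embedding V N x) = canonical_embedding V N x \<mu>"
      unfolding \<tau>_def using canonical_embedding_in_bidual[OF that]
      by (simp add: canonical_embedding_def[of "dual V N"] bidual_eq_dual_dual)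
    then show ?thesis using \<mu> by (simp add: canonical_embedding_def)
  qed
  ultimately have P\<tau>_app: "P \<tau> (canonical_embedding V N x) = \<mu> x" if "x \<in> V" for x
    using that by simp
  have le_P\<tau>: "dual_norm V N \<mu> \<le> ?n (P \<tau>)"
  proof (rule dual_norm_le)
    fix x assume x: "x \<in> V"
    have "\<bar>\<mu> x\<bar> \<le> ?n (P \<tau>) * bidual_norm V N (canonical_embedding V N x)"
      using B.dual_norm_bound[OF P_mem[OF \<tau>] canonical_embedding_in_bidual[OF x]] P\<tau>_app[OF x] by simp
    also have "\<dots> \<le> ?n (P \<tau>) * N x"
      by (intro mult_left_mono canonical_embedding_norm_le x T.nonneg P_mem \<tau>)
    finally show "\<bar>\<mu> x\<bar> \<le> ?n (P \<tau>) * N x" .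
  qed (rule T.nonneg[OF P_mem[OF \<tau>]])
  \<comment> \<open>\<open>P \<tau>\<close> and \<open>\<tau>\<close> both extend \<open>\<mu>\<close>; the smaller norm of \<open>\<tau>\<close> leaves no room for \<open>\<tau> - P \<tau>\<close>\<close>
  have "?n (\<tau> - P \<tau>) = 0"
    using bspec[OF P_norm \<tau>] \<tau>_le le_P\<tau> T.nonneg[OF diff] by linarith
  then have P\<tau>: "P \<tau> = \<tau>" using T.eq_zero_iff[OF diff] by simp
  have "?n (\<tau> + \<psi>) = ?n \<tau> + ?n \<psi>"
    using bspec[OF P_norm T.add_mem[OF \<tau> \<psi>T]] P_add[OF \<tau> \<psi>T] by (simp add: P\<tau> P\<psi>)
  moreover have "?n \<tau> = dual_norm V N \<mu>" using \<tau>_le le_P\<tau> P\<tau> by simp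
  ultimately show ?thesis by (simp add: \<tau>_def)
qed

end

section \<open>Retractions and the predual\<close>

lemma ultrametricD:
  fixes x y z :: "'a::metric_space"
  shows "ultrametric TYPE('a) \<Longrightarrow> dist x y \<le> max (dist x z) (dist z y)"
  unfolding ultrametric_def by blast

lemma ultrametric_dist_eq:
  fixes x y w :: "'a::metric_space"
  assumes "ultrametric TYPE('a)" "dist x y < dist x w"
  shows "dist y w = dist x w"
  using ultrametricD[OF assms(1), of x w y] ultrametricD[OF assms(1), of y w x] assms(2)
    dist_commute[of x y] by linarith

lemma retr_in_range: "\<exists>k\<le>n. retr s n x = s k"
  unfolding retr_def by (intro exI[of _ "nearest_index s n x"]) (simp add: nearest_index_spec(1))

lemma dist_retr_le: "k \<le> n \<Longrightarrow> dist x (retr s n x) \<le> dist x (s k)"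
  unfolding retr_def by (rule nearest_index_spec(2))

lemma dist_retr_mono: "n \<le> m \<Longrightarrow> dist x (retr s m x) \<le> dist x (retr s n x)"
  unfolding retr_def using nearest_index_spec(1)[of s n x]
  by (intro nearest_index_spec(2)) simp

lemma retr_fixes: "k \<le> n \<Longrightarrow> retr s n (s k) = s k"
  using dist_retr_le[of k n "s k" s] by (simp only: dist_self dist_le_zero_iff)

text \<open>
  If \<open>y\<close> is closer to \<open>x\<close> than every one of the first \<open>n + 1\<close> terms, then both points have the same
  distances to all these terms, hence the same nearest one.
\<close>

lemma dist_retr_le_dist:
  fixes x y :: "'a::metric_space"
  assumes um: "ultrametric TYPE('a)" and "retr s n x \<noteq> retr s n y"
  shows "dist x (retr s n x) \<le> dist x y"
proof (rule ccontr)
  assume "\<not> ?thesis"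
  then have "dist y (s j) = dist x (s j)" if "j \<le> n" for j
    using dist_retr_le[OF that, of x s] by (intro ultrametric_dist_eq[OF um]) auto
  then have "nearest_index s n y = nearest_index s n x"
    using nearest_index_spec[where s=s and n=n and x=x] by (intro nearest_index_eqI) auto
  with assms(2) show False by (simp add: retr_def)
qed

lemma retr_nonexpansive:
  fixes x y :: "'a::metric_space"
  assumes um: "ultrametric TYPE('a)"
  shows "dist (retr s n x) (retr s n y) \<le> dist x y"
proof (cases "retr s n x = retr s n y")
  case False
  have "dist (retr s n x) x \<le> dist x y" "dist y (retr s n y) \<le> dist x y"
    using dist_retr_le_dist[OF um False] dist_retr_le_dist[OF um not_sym[OF False]]
    by (simp_all add: dist_commute)
  then show ?thesis
    using ultrametricD[OF um, of "retr s n x" "retr s n y" x] ultrametricD[OF um, of x "retr s n y" y]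
    by linarith
qed simp

lemma retr_far:
  fixes x :: "'a::metric_space"
  assumes um: "ultrametric TYPE('a)" and "\<And>k. k \<le> n \<Longrightarrow> dist (s 0) (s k) < dist (s 0) x"
  shows "retr s n x = s 0"
proof -
  have "dist x (s 0) \<le> dist x (s k)" if "k \<le> n" for k
    using ultrametric_dist_eq[OF um assms(2)[OF that]] by (simp add: dist_commute)
  then have "nearest_index s n x = 0" by (intro nearest_index_eqI) auto
  then show ?thesis by (simp add: retr_def)
qed

lemma retr_far_radius:
  fixes s :: "nat \<Rightarrow> 'a::metric_space"
  assumes um: "ultrametric TYPE('a)"
  obtains \<rho> where "\<rho> \<ge> 0" "\<And>x. \<rho> < dist (s 0) x \<Longrightarrow> retr s n x = s 0"
proof -
  define r where "r = Max ((\<lambda>k. dist (s 0) (s k)) ` {..n})"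
  have le: "dist (s 0) (s k) \<le> r" if "k \<le> n" for k
    unfolding r_def using that by (intro Max_ge) auto
  show thesis
  proof (rule that)
    have "dist (s 0) (s 0) \<le> r" by (rule le) simp
    then show "r \<ge> 0" by (simp only: dist_self)
    fix x assume x: "r < dist (s 0) x"
    show "retr s n x = s 0"
    proof (rule retr_far[OF um])
      fix k assume "k \<le> n"
      from le[OF this] x show "dist (s 0) (s k) < dist (s 0) x" by (rule le_less_trans)
    qed
  qed
qed

lemma retr_fibres_separated:
  fixes s :: "nat \<Rightarrow> 'a::metric_space"
  assumes um: "ultrametric TYPE('a)"
  obtains \<sigma> where "\<sigma> > 0" "\<And>x y. retr s n x \<noteq> retr s n y \<Longrightarrow> \<sigma> \<le> dist x y"
proof -
  define A where "A = insert 1 ((\<lambda>(a, b). dist a b) ` (s ` {..n} \<times> s ` {..n} - Id))"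
  have fin: "finite A" unfolding A_def by (intro finite.insertI finite_imageI finite_Diff finite_cartesian_product finite_atMost)
  have pos: "0 < a" if "a \<in> A" for a using that by (force simp: A_def)
  show thesis
  proof (rule that)
    have "Min A \<in> A" by (rule Min_in[OF fin]) (simp add: A_def)
    then show "Min A > 0" by (rule pos)
    show "Min A \<le> dist x y" if "retr s n x \<noteq> retr s n y" for x y
    proof -
      have "dist (retr s n x) (retr s n y) \<in> A"
        unfolding A_def using that retr_in_range[of n s x] retr_in_range[of n s y]
        by (intro insertI2 image_eqI[of _ _ "(retr s n x, retr s n y)"]) auto
      with fin have "Min A \<le> dist (retr s n x) (retr s n y)" by (rule Min_le)
      also have "\<dots> \<le> dist x y" by (rule retr_nonexpansive[OF um])
      finally show ?thesis .
    qed
  qed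
qed

lemma Lip0_zero: "f \<in> Lip0 z \<Longrightarrow> f z = 0"
  by (simp add: Lip0_def)

lemma Lip0_lipschitz:
  assumes "f \<in> Lip0 z" shows "\<bar>f x - f y\<bar> \<le> lip_norm f * dist x y"
proof -
  obtain C where "C-lipschitz_on UNIV f" using assms by (auto simp: Lip0_def)
  from lipschitz_onD[OF lip_norm_lipschitz[OF this], of x y] show ?thesis by (simp add: dist_real_def)
qed

lemma lip_norm_nonneg: "f \<in> Lip0 z \<Longrightarrow> 0 \<le> lip_norm f"
  using normed_space_on.nonneg[OF Lip0_normed_space] .

lemma lip_norm_leI:
  assumes "0 \<le> C" "\<And>x y. \<bar>f x - f y\<bar> \<le> C * dist x y"
  shows "lip_norm f \<le> C"
  using assms by (intro lip_norm_le lipschitz_onI) (auto simp: dist_real_def)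

lemma Lip0I:
  assumes "0 \<le> C" "\<And>x y. \<bar>f x - f y\<bar> \<le> C * dist x y" "f z = 0"
  shows "f \<in> Lip0 z"
  using assms unfolding Lip0_def by (auto intro!: exI[of _ C] lipschitz_onI simp: dist_real_def)

lemma predual_Lip0: "f \<in> predual z s \<Longrightarrow> f \<in> Lip0 z"
  by (simp add: predual_def)

lemma predual_fibre_constant:
  assumes "f \<in> Lip0 z" "\<And>x y. retr s n x = retr s n y \<Longrightarrow> f x = f y"
  shows "f \<in> predual z s"
proof -
  have "\<bar>f x - f y\<bar> \<le> \<epsilon> * dist x y" if "\<epsilon> > 0" "retr s n x = retr s n y" for \<epsilon> x y
    using that assms(2)[of x y] by simp
  with assms(1) show ?thesis by (auto simp: predual_def)
qed

lemma comp_retr_lipschitz: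
  fixes x y :: "'a::metric_space"
  assumes um: "ultrametric TYPE('a)" and f: "f \<in> Lip0 z"
  shows "\<bar>f (retr s n x) - f (retr s n y)\<bar> \<le> lip_norm f * dist x y"
  using Lip0_lipschitz[OF f, of "retr s n x" "retr s n y"]
    mult_left_mono[OF retr_nonexpansive[OF um] lip_norm_nonneg[OF f], of s n x y] by linarith

lemma comp_retr_in_predual:
  fixes s :: "nat \<Rightarrow> 'a::metric_space"
  assumes um: "ultrametric TYPE('a)" and f: "f \<in> Lip0 (s 0)"
  shows "(\<lambda>x. f (retr s n x)) \<in> predual (s 0) s"
    and "lip_norm (\<lambda>x. f (retr s n x)) \<le> lip_norm f"
proof -
  show "(\<lambda>x. f (retr s n x)) \<in> predual (s 0) s"
    using comp_retr_lipschitz[OF um f] lip_norm_nonneg[OF f]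
    by (intro predual_fibre_constant[of _ _ s n] Lip0I[of "lip_norm f"]) (auto simp: retr_fixes Lip0_zero[OF f])
  show "lip_norm (\<lambda>x. f (retr s n x)) \<le> lip_norm f"
    by (rule lip_norm_leI[OF lip_norm_nonneg[OF f] comp_retr_lipschitz[OF um f]])
qed

text \<open>
  The functions that span the range of \<open>g \<mapsto> g \<circ> r\<^sub>n\<close>; by \<open>comp_retr_eq_sum\<close> below this operator
  has finite rank.
\<close>

definition fibre_indicator :: "(nat \<Rightarrow> 'a::metric_space) \<Rightarrow> nat \<Rightarrow> nat \<Rightarrow> 'a \<Rightarrow> real" where
  "fibre_indicator s n k x = (if retr s n x = s k then 1 else 0)"

lemma fibre_indicator_in_predual:
  fixes s :: "nat \<Rightarrow> 'a::metric_space"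
  assumes um: "ultrametric TYPE('a)" and "s k \<noteq> s 0"
  shows "fibre_indicator s n k \<in> predual (s 0) s"
proof -
  obtain \<sigma> where \<sigma>: "\<sigma> > 0" "\<And>x y. retr s n x \<noteq> retr s n y \<Longrightarrow> \<sigma> \<le> dist x y"
    using retr_fibres_separated[OF um, of s n] by blast
  have "\<bar>fibre_indicator s n k x - fibre_indicator s n k y\<bar> \<le> 1 / \<sigma> * dist x y" for x y
    using \<sigma>(1) \<sigma>(2)[of x y] by (auto simp: fibre_indicator_def field_simps)
  then show ?thesis using \<sigma>(1) assms(2)
    by (intro predual_fibre_constant[of _ _ s n] Lip0I[of "1 / \<sigma>"]) (auto simp: fibre_indicator_def retr_fixes)
qed

text \<open>
  Evaluation at \<open>x\<close> as an element of the dual of the predual, hence extended by 0.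
\<close>

definition point_eval :: "'a::metric_space \<Rightarrow> (nat \<Rightarrow> 'a) \<Rightarrow> 'a \<Rightarrow> ('a \<Rightarrow> real) \<Rightarrow> real" where
  "point_eval z s x f = (if f \<in> predual z s then f x else 0)"

lemma point_eval_in_dual:
  fixes s :: "nat \<Rightarrow> 'a::metric_space"
  assumes um: "ultrametric TYPE('a)"
  shows "point_eval z s x \<in> dual (predual z s) lip_norm"
proof -
  interpret Y: normed_space_on "predual z s" lip_norm by (rule predual_normed_space[OF um])
  show ?thesis
  proof (rule Y.dualI)
    fix f assume f: "f \<in> predual z s"
    show "\<bar>point_eval z s x f\<bar> \<le> dist x z * lip_norm f"
      using Lip0_lipschitz[OF predual_Lip0[OF f], of x z] Lip0_zero[OF predual_Lip0[OF f]] f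
      by (simp add: point_eval_def mult.commute)
  qed (auto simp: point_eval_def Y.add_mem Y.scaleR_mem, simp add: scaleR_fun_def)
qed

lemma point_eval_diff_norm_le:
  fixes s :: "nat \<Rightarrow> 'a::metric_space"
  assumes um: "ultrametric TYPE('a)"
  shows "dual_norm (predual z s) lip_norm (point_eval z s x - point_eval z s y) \<le> dist x y"
proof -
  interpret Y: normed_space_on "predual z s" lip_norm by (rule predual_normed_space[OF um])
  show ?thesis
    by (rule Y.dual_norm_le)
      (use Lip0_lipschitz[OF predual_Lip0] in \<open>auto simp: point_eval_def mult.commute\<close>)
qed

lemma comp_retr_eq_sum:
  assumes "inj s" "g (s 0) = 0"
  shows "g (retr s n x) = (\<Sum>k\<in>{1..n}. g (s k) * fibre_indicator s n k x)"
proof -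
  obtain i where i: "i \<le> n" "retr s n x = s i" using retr_in_range by blast
  have "(\<Sum>k\<in>{1..n}. g (s k) * fibre_indicator s n k x) = (\<Sum>k\<in>{1..n}. if k = i then g (s i) else 0)"
    using i(2) assms(1) by (intro sum.cong) (auto simp: fibre_indicator_def inj_eq)
  also have "\<dots> = g (s i)" using i(1) assms(2) by (cases "i = 0") auto
  finally show ?thesis by (simp add: i(2))
qed

section \<open>Proper spaces\<close>

text \<open>
  A function in the predual varies noticeably only on pairs that \<open>r\<^sub>n\<close> separates and that stay in a
  fixed ball. If \<open>x\<close> is far away, then \<open>r\<^sub>n x\<close> is the base point, so \<open>f x\<close> is small compared with the
  distance from \<open>x\<close> to the base point; the other point of a separated pair is then near the base
  point, at the same large distance from \<open>x\<close>.
\<close>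

lemma predual_variation:
  fixes s :: "nat \<Rightarrow> 'a::metric_space"
  assumes um: "ultrametric TYPE('a)" and f: "f \<in> predual (s 0) s" and "\<epsilon> > 0"
  obtains n \<rho> where "\<And>x y. \<epsilon> * dist x y < \<bar>f x - f y\<bar> \<Longrightarrow>
    retr s n x \<noteq> retr s n y \<and> dist (s 0) x \<le> \<rho>"
proof -
  have f0: "f (s 0) = 0" and fL: "f \<in> Lip0 (s 0)" using f by (auto simp: predual_def Lip0_def)
  define L where "L = lip_norm f"
  have L: "L \<ge> 0" unfolding L_def by (rule lip_norm_nonneg[OF fL])
  obtain n where n: "\<And>x y. retr s n x = retr s n y \<Longrightarrow> \<bar>f x - f y\<bar> \<le> \<epsilon> / 2 * dist x y"
    using f half_gt_zero[OF \<open>\<epsilon> > 0\<close>] unfolding predual_def by blast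
  obtain r where r: "r \<ge> 0" "\<And>x. r < dist (s 0) x \<Longrightarrow> retr s n x = s 0"
    using retr_far_radius[OF um, of s n] by blast
  define \<rho> where "\<rho> = r + 2 * L * r / \<epsilon>"
  show thesis
  proof (rule that[of n \<rho>])
    fix x y assume big: "\<epsilon> * dist x y < \<bar>f x - f y\<bar>"
    have ne: "retr s n x \<noteq> retr s n y"
    proof
      assume "retr s n x = retr s n y"
      from n[OF this] have "\<bar>f x - f y\<bar> \<le> \<epsilon> * dist x y"
        using mult_nonneg_nonneg[OF less_imp_le[OF \<open>\<epsilon> > 0\<close>] zero_le_dist[of x y]] by simp
      with big show False by simp
    qed
    have "dist (s 0) x \<le> \<rho>"
    proof (rule ccontr)
      assume "\<not> ?thesis"
      then have far: "r + 2 * L * r / \<epsilon> < dist (s 0) x" by (simp add: \<rho>_def)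
      moreover have nn: "2 * L * r / \<epsilon> \<ge> 0" using L r \<open>\<epsilon> > 0\<close> by simp
      ultimately have rx: "retr s n x = s 0" by (intro r) linarith
      with ne have y: "dist (s 0) y \<le> r" using r(2)[of y] by force
      have "dist (s 0) y < dist (s 0) x" using y far nn by linarith
      then have d: "dist x y = dist (s 0) x"
        using ultrametric_dist_eq[OF um] by (metis dist_commute)
      have "\<bar>f x - f (s 0)\<bar> \<le> \<epsilon> / 2 * dist x (s 0)" by (rule n) (simp add: rx retr_fixes)
      moreover have "\<bar>f (s 0) - f y\<bar> \<le> L * r"
        using Lip0_lipschitz[OF fL, of "s 0" y] mult_left_mono[OF y L] by (simp add: L_def)
      moreover have "L * r \<le> \<epsilon> / 2 * dist (s 0) x"
      proof -
        have "2 * L * r / \<epsilon> \<le> dist (s 0) x" using far r(1) by linarith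
        then show ?thesis using \<open>\<epsilon> > 0\<close> by (simp add: field_simps)
      qed
      ultimately have "\<bar>f x - f y\<bar> \<le> \<epsilon> * dist x y" by (simp add: d dist_commute f0)
      with big show False by simp
    qed
    with ne show "retr s n x \<noteq> retr s n y \<and> dist (s 0) x \<le> \<rho>" by blast
  qed
qed

lemma retr_uniform_on_balls:
  fixes s :: "nat \<Rightarrow> 'a::metric_space"
  assumes "proper_metric TYPE('a)" "closure (range s) = UNIV" "\<eta> > 0"
  obtains n where "\<And>m x. n \<le> m \<Longrightarrow> dist w x \<le> \<rho> \<Longrightarrow> dist x (retr s m x) \<le> \<eta>"
proof -
  have "compact (cball w \<rho>)" using assms(1) by (simp add: proper_metric_def)
  moreover have "cball w \<rho> \<subseteq> (\<Union>k\<in>UNIV. ball (s k) \<eta>)"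
  proof
    fix x
    have "x \<in> closure (range s)" using assms(2) by simp
    then show "x \<in> (\<Union>k\<in>UNIV. ball (s k) \<eta>)"
      using \<open>\<eta> > 0\<close> by (auto simp: closure_approachable)
  qed
  ultimately obtain K where K: "finite K" "cball w \<rho> \<subseteq> (\<Union>k\<in>K. ball (s k) \<eta>)"
    using compactE_image[of "cball w \<rho>" UNIV "\<lambda>k. ball (s k) \<eta>"] by auto
  show thesis
  proof (rule that[of "Max (insert 0 K)"])
    fix m x assume m: "Max (insert 0 K) \<le> m" and x: "dist w x \<le> \<rho>"
    from x K(2) obtain k where k: "k \<in> K" "dist (s k) x < \<eta>" by (auto simp: subset_iff)
    have "k \<le> Max (insert 0 K)" using k K(1) by (intro Max_ge) auto
    with m k dist_retr_le[of k m x s] show "dist x (retr s m x) \<le> \<eta>" by (simp add: dist_commute)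
  qed
qed

text \<open>
  Indices growing so fast that a pair separated by \<open>r\<close> at index \<open>n i\<close> is large compared with the
  displacement at every later index. Separated pairs have distance at least some \<open>\<sigma> > 0\<close>, so
  this is a matter of making later displacements small uniformly on a ball. For far points this fails,
  but of two separated points at least one lies near the base point, which is why the second
  property concerns only one of them.
\<close>

lemma lacunary_scales:
  fixes s :: "nat \<Rightarrow> 'a::metric_space"
  assumes um: "ultrametric TYPE('a)" and "proper_metric TYPE('a)" "closure (range s) = UNIV" "\<epsilon> > 0"
  obtains n :: "nat \<Rightarrow> nat" where "n 0 = n\<^sub>0"
    "\<And>i j x y. i < j \<Longrightarrow> retr s (n i) x \<noteq> retr s (n i) y \<Longrightarrow> dist (s 0) x \<le> \<rho> \<Longrightarrow>
       dist x (retr s (n j) x) \<le> \<epsilon> * dist x y"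
    "\<And>i j x y. i < j \<Longrightarrow> retr s (n i) x \<noteq> retr s (n i) y \<Longrightarrow>
       dist x (retr s (n j) x) \<le> \<epsilon> * dist x y \<or> dist y (retr s (n j) y) \<le> \<epsilon> * dist x y"
proof -
  define Q where "Q n n' \<longleftrightarrow> n \<le> n' \<and> (\<forall>m\<ge>n'. \<forall>x y. retr s n x \<noteq> retr s n y \<longrightarrow>
      (dist (s 0) x \<le> \<rho> \<longrightarrow> dist x (retr s m x) \<le> \<epsilon> * dist x y) \<and>
      (dist x (retr s m x) \<le> \<epsilon> * dist x y \<or> dist y (retr s m y) \<le> \<epsilon> * dist x y))" for n n'
  have "\<exists>n'. Q n n'" for n
  proof -
    obtain \<sigma> where \<sigma>: "\<sigma> > 0" "\<And>x y. retr s n x \<noteq> retr s n y \<Longrightarrow> \<sigma> \<le> dist x y"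
      using retr_fibres_separated[OF um, of s n] by blast
    obtain r where r: "r \<ge> 0" "\<And>x. r < dist (s 0) x \<Longrightarrow> retr s n x = s 0"
      using retr_far_radius[OF um, of s n] by blast
    have "\<epsilon> * \<sigma> > 0" using \<sigma> \<open>\<epsilon> > 0\<close> by simp
    then obtain n' where n': "\<And>m x. n' \<le> m \<Longrightarrow> dist (s 0) x \<le> max r \<rho> \<Longrightarrow> dist x (retr s m x) \<le> \<epsilon> * \<sigma>"
      using retr_uniform_on_balls[OF assms(2,3)] by blast
    have "Q n (max n n')"
      unfolding Q_def
    proof (intro conjI allI impI)
      fix m x y assume m: "max n n' \<le> m" and ne: "retr s n x \<noteq> retr s n y"
      have small: "dist w (retr s m w) \<le> \<epsilon> * dist x y" if "dist (s 0) w \<le> max r \<rho>" for w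
        using n'[OF _ that, of m] m mult_left_mono[OF \<sigma>(2)[OF ne] less_imp_le[OF \<open>\<epsilon> > 0\<close>]] by simp
      then show "dist x (retr s m x) \<le> \<epsilon> * dist x y" if "dist (s 0) x \<le> \<rho>" using that by simp
      have "dist (s 0) x \<le> r \<or> dist (s 0) y \<le> r"
        using ne r(2)[of x] r(2)[of y] by force
      then show "dist x (retr s m x) \<le> \<epsilon> * dist x y \<or> dist y (retr s m y) \<le> \<epsilon> * dist x y"
        using small by fastforce
    qed simp
    then show ?thesis ..
  qed
  then obtain F where F: "\<And>n. Q n (F n)" by metis
  define n where "n i = (F ^^ i) n\<^sub>0" for i
  have Q: "Q (n i) (n (Suc i))" for i using F by (simp add: n_def)
  have mono: "mono n" using Q by (intro incseq_SucI) (simp add: Q_def)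
  show thesis
  proof (rule that)
    show "n 0 = n\<^sub>0" by (simp add: n_def)
    fix i j :: nat and x y assume "i < j" and ne: "retr s (n i) x \<noteq> retr s (n i) y"
    then have "n (Suc i) \<le> n j" by (intro monoD[OF mono]) simp
    with Q[of i] ne
    show "dist x (retr s (n j) x) \<le> \<epsilon> * dist x y \<or> dist y (retr s (n j) y) \<le> \<epsilon> * dist x y"
      and "dist (s 0) x \<le> \<rho> \<Longrightarrow> dist x (retr s (n j) x) \<le> \<epsilon> * dist x y"
      unfolding Q_def by blast+
  qed
qed

text \<open>
  For a pair \<open>x\<close>, \<open>y\<close> let \<open>h j\<close> be the increment of \<open>g - g \<circ> r\<^bsub>n j\<^esub>\<close>, and let \<open>i\<close> be the first
  index with \<open>r\<^bsub>n i\<^esub> x \<noteq> r\<^bsub>n i\<^esub> y\<close>. For \<open>j < i\<close> it is the increment of \<open>g\<close>. For \<open>j > i\<close> one of the points is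
  hardly displaced and the other at most by \<open>d(x, y)\<close>. Only \<open>j = i\<close> may give \<open>2 d(x, y)\<close>, and
  averaging makes this negligible. If in addition \<open>f\<close> varies on the pair, then \<open>i = 0\<close> and both
  points lie in the ball where displacements are small, so that all but one of the \<open>h j\<close> are small and
  the increments of \<open>f\<close> and \<open>g\<close> do not add up.
\<close>

lemma averaged_remainder_bound:
  fixes s :: "nat \<Rightarrow> 'a::metric_space"
  assumes um: "ultrametric TYPE('a)" and "proper_metric TYPE('a)" "closure (range s) = UNIV" "\<epsilon> > 0"
    and f: "f \<in> predual (s 0) s" "lip_norm f \<le> 1"
  obtains m :: nat and n :: "nat \<Rightarrow> nat" where "m > 0"
    "\<And>g x y. g \<in> Lip0 (s 0) \<Longrightarrow> lip_norm g \<le> 1 \<Longrightarrow>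
      \<bar>f x - f y\<bar> + \<bar>(g x - (\<Sum>j<m. g (retr s (n j) x)) / m) - (g y - (\<Sum>j<m. g (retr s (n j) y)) / m)\<bar>
        \<le> (1 + \<epsilon>) * dist x y"
proof -
  define \<delta> where "\<delta> = \<epsilon> / 4"
  have \<delta>: "\<delta> > 0" using \<open>\<epsilon> > 0\<close> by (simp add: \<delta>_def)
  obtain n\<^sub>0 \<rho> where f_var: "\<And>x y. \<delta> * dist x y < \<bar>f x - f y\<bar> \<Longrightarrow>
      retr s n\<^sub>0 x \<noteq> retr s n\<^sub>0 y \<and> dist (s 0) x \<le> \<rho>"
    using predual_variation[OF um f(1) \<delta>] by blast
  obtain n :: "nat \<Rightarrow> nat" where n0: "n 0 = n\<^sub>0"
    and near: "\<And>i j x y. i < j \<Longrightarrow> retr s (n i) x \<noteq> retr s (n i) y \<Longrightarrow> dist (s 0) x \<le> \<rho> \<Longrightarrow>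
       dist x (retr s (n j) x) \<le> \<delta> * dist x y"
    and one: "\<And>i j x y. i < j \<Longrightarrow> retr s (n i) x \<noteq> retr s (n i) y \<Longrightarrow>
       dist x (retr s (n j) x) \<le> \<delta> * dist x y \<or> dist y (retr s (n j) y) \<le> \<delta> * dist x y"
    using lacunary_scales[OF um assms(2,3) \<delta>, of n\<^sub>0 \<rho>] by blast
  obtain m :: nat where m: "m > 0" "2 / m \<le> \<delta>"
  proof -
    obtain m :: nat where "2 / \<delta> < m" using reals_Archimedean2 by blast
    moreover from this have "m > 0" using \<delta> by (cases "m = 0") auto
    ultimately show thesis using \<delta> by (intro that[of m]) (auto simp: field_simps)
  qed
  show thesis
  proof (rule that[OF m(1)])
    fix g and x y :: 'a assume g: "g \<in> Lip0 (s 0)" "lip_norm g \<le> 1"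
    have g_lip: "\<bar>g u - g v\<bar> \<le> dist u v" for u v
      using Lip0_lipschitz[OF g(1), of u v] mult_right_mono[OF g(2), of "dist u v"] by simp
    let ?d = "dist x y"
    define h where "h j = (g x - g (retr s (n j) x)) - (g y - g (retr s (n j) y))" for j
    have h2: "\<bar>h j\<bar> \<le> 2 * ?d" for j
      using g_lip[of x y] g_lip[of "retr s (n j) x" "retr s (n j) y"] retr_nonexpansive[OF um, of s "n j" x y]
      unfolding h_def by linarith
    have h_disp: "\<bar>h j\<bar> \<le> dist x (retr s (n j) x) + dist y (retr s (n j) y)" for j
      using g_lip[of x "retr s (n j) x"] g_lip[of y "retr s (n j) y"] unfolding h_def by linarith
    \<comment> \<open>one exceptional index \<open>i\<close> contributes at most \<open>2 / m\<close> to the average\<close>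
    have avg: "\<bar>(\<Sum>j<m. h j) / m\<bar> \<le> A * ?d + \<delta> * ?d"
      if "\<And>j. j \<noteq> i \<Longrightarrow> \<bar>h j\<bar> \<le> A * ?d" "A \<ge> 0" for A i
    proof -
      have "\<bar>\<Sum>j<m. h j\<bar> \<le> (\<Sum>j<m. A * ?d + (if j = i then 2 * ?d else 0))"
        using that h2 by (intro sum_abs[THEN order_trans] sum_mono) (auto intro: add_increasing)
      also have "\<dots> \<le> m * (A * ?d) + 2 * ?d" by (simp add: sum.distrib)
      finally have "\<bar>\<Sum>j<m. h j\<bar> / m \<le> A * ?d + 2 / m * ?d"
        using m(1) by (simp add: field_simps)
      also have "2 / m * ?d \<le> \<delta> * ?d" by (intro mult_right_mono m) auto
      finally show ?thesis by simp
    qed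
    have "(g x - (\<Sum>j<m. g (retr s (n j) x)) / m) - (g y - (\<Sum>j<m. g (retr s (n j) y)) / m) = (\<Sum>j<m. h j) / m"
      using m(1) by (simp add: h_def sum_subtractf diff_divide_distrib)
    moreover have "\<bar>f x - f y\<bar> + \<bar>(\<Sum>j<m. h j) / m\<bar> \<le> (1 + \<epsilon>) * ?d"
    proof (cases "\<bar>f x - f y\<bar> \<le> \<delta> * ?d")
      case True
      define i where "i = (LEAST i. retr s (n i) x \<noteq> retr s (n i) y)"
      have "\<bar>h j\<bar> \<le> (1 + \<delta>) * ?d" if "j \<noteq> i" for j
      proof (cases "retr s (n j) x = retr s (n j) y")
        case True
        have "0 \<le> \<delta> * ?d" using \<delta> by simp
        with g_lip[of x y] True show ?thesis by (simp add: h_def algebra_simps)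
      next
        case False
        then have "i \<le> j" unfolding i_def by (rule Least_le)
        with that have "i < j" by simp
        moreover have "retr s (n i) x \<noteq> retr s (n i) y" unfolding i_def using False by (rule LeastI)
        ultimately have "dist x (retr s (n j) x) \<le> \<delta> * dist x y \<or> dist y (retr s (n j) y) \<le> \<delta> * dist x y"
          by (rule one)
        with dist_retr_le_dist[OF um False] dist_retr_le_dist[OF um not_sym[OF False]] h_disp[of j]
        show ?thesis by (auto simp: algebra_simps dist_commute)
      qed
      then have "\<bar>(\<Sum>j<m. h j) / m\<bar> \<le> (1 + \<delta>) * ?d + \<delta> * ?d" using \<delta> by (intro avg) auto
      moreover have "\<epsilon> * ?d = 4 * (\<delta> * ?d)" "\<delta> * ?d \<ge> 0" using \<delta> by (simp_all add: \<delta>_def)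
      ultimately show ?thesis using True by (simp only: distrib_right mult_1_left)
    next
      case False
      have "\<bar>h j\<bar> \<le> 2 * \<delta> * ?d" if "j \<noteq> 0" for j
        using near[of 0 j x y] near[of 0 j y x] f_var[of x y] f_var[of y x] False that n0 h_disp[of j]
        by (simp add: dist_commute abs_minus_commute)
      from avg[of 0 "2 * \<delta>", OF this] \<delta> have "\<bar>(\<Sum>j<m. h j) / m\<bar> \<le> 2 * \<delta> * ?d + \<delta> * ?d" by simp
      moreover have "\<bar>f x - f y\<bar> \<le> ?d"
        using Lip0_lipschitz[OF predual_Lip0[OF f(1)], of x y] mult_right_mono[OF f(2), of ?d] by simp
      moreover have "\<epsilon> * ?d \<ge> 0" using \<open>\<epsilon> > 0\<close> by simp
      ultimately show ?thesis unfolding \<delta>_def by (simp add: algebra_simps)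
    qed
    ultimately show "\<bar>f x - f y\<bar> + \<bar>(g x - (\<Sum>j<m. g (retr s (n j) x)) / m) - (g y - (\<Sum>j<m. g (retr s (n j) y)) / m)\<bar>
        \<le> (1 + \<epsilon>) * dist x y" by (simp only:)
  qed
qed

theorem M_embedded_if_proper:
  fixes s :: "nat \<Rightarrow> 'a::metric_space"
  assumes um: "ultrametric TYPE('a)" and proper: "proper_metric TYPE('a)"
    and inj: "inj s" and dense: "closure (range s) = UNIV"
  shows "M_embedded (predual (s 0) s) lip_norm"
proof -
  interpret Y: normed_space_on "predual (s 0) s" lip_norm by (rule predual_normed_space[OF um])
  show ?thesis
  proof (rule Y.M_embeddedI)
    fix f and \<epsilon> :: real assume f: "f \<in> predual (s 0) s" "lip_norm f \<le> 1" and "\<epsilon> > 0"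
    obtain m :: nat and n :: "nat \<Rightarrow> nat" where m: "m > 0" and
      bound: "\<And>g x y. g \<in> Lip0 (s 0) \<Longrightarrow> lip_norm g \<le> 1 \<Longrightarrow>
        \<bar>f x - f y\<bar> + \<bar>(g x - (\<Sum>j<m. g (retr s (n j) x)) / m) - (g y - (\<Sum>j<m. g (retr s (n j) y)) / m)\<bar>
          \<le> (1 + \<epsilon>) * dist x y"
      using averaged_remainder_bound[OF um proper dense \<open>\<epsilon> > 0\<close> f] by blast
    define I where "I = (SIGMA j:{..<m}. {1..n j})"
    define e where "e p = point_eval (s 0) s (s (snd p))" for p :: "nat \<times> nat"
    define v where "v p = (1 / m) *\<^sub>R fibre_indicator s (n (fst p)) (snd p)" for p :: "nat \<times> nat"
    have R: "(\<Sum>p\<in>I. e p g *\<^sub>R v p) x = (\<Sum>j<m. g (retr s (n j) x)) / m"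
      if g: "g \<in> predual (s 0) s" for g x
    proof -
      have "g (s 0) = 0" by (rule Lip0_zero[OF predual_Lip0[OF g]])
      then show ?thesis
        using g by (simp add: comp_retr_eq_sum[OF inj, of g] sum_fun_apply I_def e_def v_def point_eval_def
            sum.Sigma scaleR_fun_def sum_divide_distrib split_def)
    qed
    show "\<exists>(I :: (nat \<times> nat) set) e v. finite I \<and> (\<forall>i\<in>I. e i \<in> dual (predual (s 0) s) lip_norm \<and> v i \<in> predual (s 0) s) \<and>
        (\<forall>g\<in>predual (s 0) s. lip_norm g \<le> 1 \<longrightarrow> lip_norm (f + (g - (\<Sum>i\<in>I. e i g *\<^sub>R v i))) \<le> 1 + \<epsilon>)"
    proof (intro exI conjI ballI impI)
      show "finite I" by (simp add: I_def)
      show "e p \<in> dual (predual (s 0) s) lip_norm" for p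
        unfolding e_def by (rule point_eval_in_dual[OF um])
      show "v p \<in> predual (s 0) s" if "p \<in> I" for p
        unfolding v_def using that inj
        by (intro Y.scaleR_mem fibre_indicator_in_predual[OF um]) (auto simp: I_def inj_eq)
      fix g assume g: "g \<in> predual (s 0) s" "lip_norm g \<le> 1"
      show "lip_norm (f + (g - (\<Sum>p\<in>I. e p g *\<^sub>R v p))) \<le> 1 + \<epsilon>"
      proof (rule lip_norm_leI)
        fix x y
        show "\<bar>(f + (g - (\<Sum>p\<in>I. e p g *\<^sub>R v p))) x - (f + (g - (\<Sum>p\<in>I. e p g *\<^sub>R v p))) y\<bar> \<le> (1 + \<epsilon>) * dist x y"
          using bound[OF predual_Lip0[OF g(1)] g(2), of x y] by (simp add: R[OF g(1)])
      qed (use \<open>\<epsilon> > 0\<close> in simp)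
    qed
  qed
qed

section \<open>Limits along ultrafilters\<close>

text \<open>
  Limits along ultrafilters provide elements of duals as weak-star cluster points.
\<close>

definition ultrafilter :: "'a filter \<Rightarrow> bool" where
  "ultrafilter U \<longleftrightarrow> U \<noteq> bot \<and> (\<forall>P. eventually P U \<or> eventually (\<lambda>x. \<not> P x) U)"

text \<open>
  A minimal proper filter below \<open>F\<close> decides every predicate: if it does not refute \<open>P\<close>, its
  restriction to \<open>P\<close> is still proper, so it is the filter itself.
\<close>

lemma ultrafilter_exists:
  assumes "F \<noteq> bot"
  obtains U where "ultrafilter U" "U \<le> F"
proof -
  define A where "A = {G. G \<noteq> bot \<and> G \<le> F}"
  have "\<exists>U\<in>A. \<forall>G\<in>A. U \<ge> G \<longrightarrow> G = U"
  proof (rule predicate_Zorn)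
    show "partial_order_on A (relation_of (\<ge>) A)"
      by (rule partial_order_on_relation_ofI) auto
    fix C assume C: "C \<in> Chains (relation_of (\<ge>) A)"
    show "\<exists>u\<in>A. \<forall>G\<in>C. G \<ge> u"
    proof (cases "C = {}")
      case True
      then show ?thesis using assms by (auto simp: A_def)
    next
      case False
      have comp: "G \<in> A \<and> (G \<le> H \<or> H \<le> G)" if "G \<in> C" "H \<in> C" for G H
        using C that unfolding Chains_def relation_of_def by blast
      then have CA: "C \<subseteq> A" by blast
      have "\<exists>x\<in>C. x \<le> inf G H" if "G \<in> C" "H \<in> C" for G H
      proof -
        from comp[OF that] consider "G \<le> inf G H" | "H \<le> inf G H" by auto
        then show ?thesis using that by cases blast+
      qed
      from eventually_Inf_base[OF False this, of "\<lambda>_. False"]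
      have "Inf C \<noteq> bot" using CA by (auto simp: trivial_limit_def A_def)
      moreover obtain G where "G \<in> C" "G \<le> F" using False CA unfolding A_def by blast
      then have "Inf C \<le> F" by (rule Inf_lower2)
      ultimately have "Inf C \<in> A" unfolding A_def by blast
      then show ?thesis using Inf_lower[of _ C] by blast
    qed
  qed
  then obtain U where "U \<in> A" and max': "\<And>G. G \<in> A \<Longrightarrow> G \<le> U \<Longrightarrow> G = U" by blast
  then have U: "U \<noteq> bot" "U \<le> F" unfolding A_def by blast+
  have max: "G = U" if "G \<noteq> bot" "G \<le> U" for G
    using max'[of G] that order_trans[OF that(2) U(2)] unfolding A_def by blast
  have "eventually P U \<or> eventually (\<lambda>x. \<not> P x) U" for P
  proof (cases "inf U (principal {x. P x}) = bot")
    case True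
    then have "eventually (\<lambda>x. False) (inf U (principal {x. P x}))" by simp
    then show ?thesis by (simp add: eventually_inf_principal)
  next
    case False
    from max[OF this] have "inf U (principal {x. P x}) = U" by simp
    then have "U \<le> principal {x. P x}" by (simp add: inf.absorb_iff1)
    then show ?thesis by (auto simp: le_principal)
  qed
  with U show thesis by (intro that) (auto simp: ultrafilter_def)
qed

lemma ultrafilter_filtermap: "ultrafilter U \<Longrightarrow> ultrafilter (filtermap f U)"
  by (simp add: ultrafilter_def filtermap_bot_iff eventually_filtermap)

lemma ultrafilter_nonbot: "ultrafilter U \<Longrightarrow> U \<noteq> bot"
  by (simp add: ultrafilter_def)

lemma ultrafilter_le_nhds:
  assumes "ultrafilter U" "inf (nhds x) U \<noteq> bot"
  shows "U \<le> nhds x"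
proof (rule filter_leI)
  fix P assume P: "eventually P (nhds x)"
  show "eventually P U"
  proof (rule ccontr)
    assume "\<not> eventually P U"
    then have "eventually (\<lambda>x. \<not> P x) U" using assms(1) by (auto simp: ultrafilter_def)
    with P have "eventually (\<lambda>x. False) (inf (nhds x) U)"
      unfolding eventually_inf by blast
    with assms(2) show False by (simp add: trivial_limit_def)
  qed
qed

lemma ultrafilter_compact:
  assumes "ultrafilter U" "compact K" "eventually (\<lambda>x. x \<in> K) U"
  obtains x where "x \<in> K" "U \<le> nhds x"
proof -
  have "\<exists>x\<in>K. inf (nhds x) U \<noteq> bot"
    using assms unfolding compact_filter ultrafilter_def by blast
  then show thesis using ultrafilter_le_nhds[OF assms(1)] that by blast
qed

lemma ultrafilter_bounded_tendsto:
  fixes u :: "'a \<Rightarrow> real"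
  assumes "ultrafilter U" "eventually (\<lambda>x. \<bar>u x\<bar> \<le> B) U"
  shows "(u \<longlongrightarrow> Lim U u) U"
proof -
  have "eventually (\<lambda>y. y \<in> {-B..B}) (filtermap u U)"
    using assms(2) by (auto simp: eventually_filtermap abs_le_iff elim!: eventually_mono)
  then obtain l where "filtermap u U \<le> nhds l"
    using ultrafilter_compact[OF ultrafilter_filtermap[OF assms(1)] compact_Icc] by blast
  then have "(u \<longlongrightarrow> l) U" by (simp add: filterlim_def)
  with tendsto_Lim[OF ultrafilter_nonbot[OF assms(1)] this] show ?thesis by simp
qed

lemma ultrafilter_finite_range:
  assumes U: "ultrafilter U" and "finite A" "\<And>x. f x \<in> A"
  obtains a where "a \<in> A" "eventually (\<lambda>x. f x = a) U"
proof (rule ccontr)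
  assume "\<not> thesis"
  then have "\<forall>a\<in>A. eventually (\<lambda>x. f x \<noteq> a) U" using U that by (auto simp: ultrafilter_def)
  then have "eventually (\<lambda>x. \<forall>a\<in>A. f x \<noteq> a) U" using \<open>finite A\<close> by (simp add: eventually_ball_finite)
  then have "eventually (\<lambda>x. False) U" using assms(3) by (auto elim!: eventually_mono)
  with U show False by (simp add: ultrafilter_def trivial_limit_def)
qed

lemma Lim_bounded_functional:
  assumes U: "ultrafilter U" and V: "normed_space_on V N"
    and lin: "\<And>i. linear_map_on V (\<phi> i)"
    and bound: "\<And>x. x \<in> V \<Longrightarrow> eventually (\<lambda>i. \<bar>\<phi> i x\<bar> \<le> C * N x) U"
  shows "(\<lambda>x. if x \<in> V then Lim U (\<lambda>i. \<phi> i x) else 0) \<in> dual V N"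
    and "\<And>x. x \<in> V \<Longrightarrow> ((\<lambda>i. \<phi> i x) \<longlongrightarrow> Lim U (\<lambda>i. \<phi> i x)) U"
proof -
  interpret normed_space_on V N by (rule V)
  note nb = ultrafilter_nonbot[OF U]
  show lim: "((\<lambda>i. \<phi> i x) \<longlongrightarrow> Lim U (\<lambda>i. \<phi> i x)) U" if "x \<in> V" for x
    by (rule ultrafilter_bounded_tendsto[OF U bound[OF that]])
  show "(\<lambda>x. if x \<in> V then Lim U (\<lambda>i. \<phi> i x) else 0) \<in> dual V N"
  proof (rule dualI)
    fix x y assume x: "x \<in> V" and y: "y \<in> V"
    have "((\<lambda>i. \<phi> i (x + y)) \<longlongrightarrow> Lim U (\<lambda>i. \<phi> i x) + Lim U (\<lambda>i. \<phi> i y)) U"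
      using tendsto_add[OF lim[OF x] lim[OF y]] lin x y by (simp add: linear_map_on_def)
    from tendsto_Lim[OF nb this] x y
    show "(if x + y \<in> V then Lim U (\<lambda>i. \<phi> i (x + y)) else 0) =
        (if x \<in> V then Lim U (\<lambda>i. \<phi> i x) else 0) + (if y \<in> V then Lim U (\<lambda>i. \<phi> i y) else 0)"
      by (simp add: add_mem)
  next
    fix c x assume x: "x \<in> V"
    have "((\<lambda>i. \<phi> i (c *\<^sub>R x)) \<longlongrightarrow> c * Lim U (\<lambda>i. \<phi> i x)) U"
      using tendsto_mult_left[OF lim[OF x], of c] lin x by (simp add: linear_map_on_def)
    from tendsto_Lim[OF nb this] x
    show "(if c *\<^sub>R x \<in> V then Lim U (\<lambda>i. \<phi> i (c *\<^sub>R x)) else 0) = c * (if x \<in> V then Lim U (\<lambda>i. \<phi> i x) else 0)"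
      by (simp add: scaleR_mem)
  next
    fix x assume x: "x \<in> V"
    have "\<bar>Lim U (\<lambda>i. \<phi> i x)\<bar> \<le> C * N x"
      by (rule tendsto_upperbound[OF tendsto_rabs[OF lim[OF x]] bound[OF x] nb])
    with x show "\<bar>if x \<in> V then Lim U (\<lambda>i. \<phi> i x) else 0\<bar> \<le> C * N x" by simp
  qed simp
qed

section \<open>Spaces that are not proper\<close>

lemma nonconvergent_ultrafilter:
  assumes "\<not> proper_metric TYPE('a::metric_space)"
  obtains U :: "'a::metric_space filter" and p r where "ultrafilter U" "eventually (\<lambda>x. dist p x \<le> r) U" "\<And>x. \<not> U \<le> nhds x"
proof -
  obtain p :: 'a and r where "\<not> compact (cball p r)" using assms by (auto simp: proper_metric_def)
  then obtain F where F: "F \<noteq> bot" "eventually (\<lambda>x. x \<in> cball p r) F" "\<And>x. x \<in> cball p r \<Longrightarrow> inf (nhds x) F = bot"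
    unfolding compact_filter by blast
  obtain U where U: "ultrafilter U" "U \<le> F" using ultrafilter_exists[OF F(1)] .
  have ev: "eventually (\<lambda>x. x \<in> cball p r) U" using U(2) F(2) by (rule filter_leD)
  show thesis
  proof (rule that[OF U(1)])
    show "eventually (\<lambda>x. dist p x \<le> r) U" using ev by simp
    show "\<not> U \<le> nhds x" for x
    proof
      assume le: "U \<le> nhds x"
      then have "filterlim (\<lambda>x. x) (nhds x) U" by (simp add: filterlim_def filtermap_ident)
      then have "x \<in> cball p r"
        using Lim_in_closed_set[OF closed_cball ev ultrafilter_nonbot[OF U(1)]] by blast
      then have "inf (nhds x) F = bot" by (rule F)
      moreover have "U \<le> inf (nhds x) F" using le U(2) by simp
      ultimately show False using ultrafilter_nonbot[OF U(1)] by (simp add: bot_unique)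
    qed
  qed
qed

lemma le_nhdsI_dist:
  fixes w :: "'a::metric_space"
  assumes "((\<lambda>x. dist x w) \<longlongrightarrow> 0) U"
  shows "U \<le> nhds w"
  using assms tendsto_dist_iff[of "\<lambda>x. x" w U] by (simp add: filterlim_def filtermap_ident)

text \<open>
  Each \<open>r\<^sub>n\<close> has finite range, so it is constant along \<open>U\<close>, with value \<open>a n\<close>, say. The balls around
  \<open>a n\<close> with radius \<open>lim d(x, a n)\<close> are nested and of positive radius; spherical completeness gives a
  common point \<open>w\<close>. Its distance \<open>c = lim d(x, w)\<close> to \<open>U\<close> is a lower bound for these radii, and it is
  attained as soon as a term of the sequence within \<open>c\<close> of \<open>w\<close> has been reached. From then on \<open>a n\<close>
  can change at most once: a change means that \<open>d(x, a n)\<close> is eventually equal to \<open>c\<close> for the old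
  value and less than \<open>c\<close> for the new one, which rules out a second change.
\<close>

lemma stable_retraction:
  fixes s :: "nat \<Rightarrow> 'a::metric_space"
  assumes um: "ultrametric TYPE('a)" and sc: "spherically_complete TYPE('a)"
    and dense: "closure (range s) = UNIV"
    and U: "ultrafilter U" and bdd: "eventually (\<lambda>x. dist p x \<le> r) U" and nonconv: "\<And>x. \<not> U \<le> nhds x"
  obtains a c N where "a \<in> range s" "c > 0" "((\<lambda>x. dist x a) \<longlongrightarrow> c) U"
    "\<And>n. n \<ge> N \<Longrightarrow> eventually (\<lambda>x. retr s n x = a) U"
proof -
  note nb = ultrafilter_nonbot[OF U]
  have "\<exists>a. a \<in> s ` {..n} \<and> eventually (\<lambda>x. retr s n x = a) U" for n
  proof -
    have "retr s n x \<in> s ` {..n}" for x using retr_in_range[of n s x] by auto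
    then show ?thesis using ultrafilter_finite_range[OF U, of "s ` {..n}" "retr s n"] by blast
  qed
  then obtain a where a_range: "\<And>n. a n \<in> s ` {..n}" and a: "\<And>n. eventually (\<lambda>x. retr s n x = a n) U"
    by metis
  define D where "D y = Lim U (\<lambda>x. dist x y)" for y
  have D: "((\<lambda>x. dist x y) \<longlongrightarrow> D y) U" for y
  proof -
    have "eventually (\<lambda>x. \<bar>dist x y\<bar> \<le> r + dist p y) U"
      using bdd by eventually_elim (metis abs_of_nonneg add_right_mono dist_commute dist_triangle order_trans zero_le_dist)
    then show ?thesis unfolding D_def by (rule ultrafilter_bounded_tendsto[OF U])
  qed
  have D_pos: "D y > 0" for y
  proof -
    have "0 \<le> D y" by (rule tendsto_lowerbound[OF D _ nb]) simp
    moreover have "D y \<noteq> 0" using D[of y] le_nhdsI_dist nonconv by force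
    ultimately show ?thesis by simp
  qed
  have D_le: "D (a n) \<le> D (s k)" if "k \<le> n" for k n
    by (rule tendsto_le[OF nb D D]) (use a[of n] in eventually_elim, metis dist_retr_le that)
  have D_triangle: "D y \<le> max (D w) (dist w y)" for y w
    by (rule tendsto_le[OF nb tendsto_max[OF D tendsto_const] D]) (simp add: ultrametricD[OF um])
  have dist_le: "dist y w \<le> max (D y) (D w)" for y w
    by (rule tendsto_le[OF nb tendsto_max[OF D D] tendsto_const])
      (use ultrametricD[OF um, of y w] in \<open>simp add: dist_commute\<close>)
  have D_mono: "D (a m) \<le> D (a n)" if "n \<le> m" for n m
    using a_range[of n] D_le[of _ m] that by fastforce
  have decseq: "decseq (\<lambda>n. cball (a n) (D (a n)))"
  proof (rule decseq_SucI, rule subsetI)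
    fix n y assume "y \<in> cball (a (Suc n)) (D (a (Suc n)))"
    then show "y \<in> cball (a n) (D (a n))"
      using D_mono[of n "Suc n"] dist_le[of "a n" "a (Suc n)"] ultrametricD[OF um, of "a n" y "a (Suc n)"] by auto
  qed
  have "(\<Inter>n. cball (a n) (D (a n))) \<noteq> {}"
    using sc[unfolded spherically_complete_def, rule_format, of "\<lambda>n. D (a n)" a] D_pos decseq by blast
  then obtain w where "\<forall>n. dist (a n) w \<le> D (a n)" by auto
  then have w: "dist (a n) w \<le> D (a n)" for n by blast
  define c where "c = D w"
  have c: "c > 0" unfolding c_def by (rule D_pos)
  have c_le: "c \<le> D (a n)" for n
    using D_triangle[of w "a n"] w[of n] by (simp add: c_def)
  obtain k where "dist (s k) w < c"
    using closure_approachable[of w "range s"] dense c by auto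
  then have "D (s k) \<le> c" using D_triangle[of "s k" w] by (simp add: c_def dist_commute)
  then have Da: "D (a n) = c" if "n \<ge> k" for n
    using c_le[of n] D_le[OF that] by simp
  have change: "eventually (\<lambda>x. dist x (a n) = c) U \<and> eventually (\<lambda>x. dist x (a m) < c) U"
    if "k \<le> n" "n \<le> m" "a m \<noteq> a n" for n m
  proof -
    have *: "eventually (\<lambda>x. dist x (a m) < dist x (a n) \<and> dist x (a n) = dist (a m) (a n)) U"
      using a[of n] a[of m]
    proof eventually_elim
      case (elim x)
      have less: "dist x (a m) < dist x (a n)"
      proof (rule ccontr)
        assume "\<not> ?thesis"
        then have eq: "dist x (retr s m x) = dist x (retr s n x)"
          using dist_retr_mono[OF that(2), of x s] elim by simp
        have "nearest_index s m x = nearest_index s n x"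
        proof (rule nearest_index_eqI)
          show "nearest_index s n x \<le> m" using nearest_index_spec(1)[of s n x] that(2) by simp
          show "dist x (s (nearest_index s n x)) \<le> dist x (s j)" if "j \<le> m" for j
            using dist_retr_le[OF that, of x s] eq by (simp add: retr_def)
          show "dist x (s (nearest_index s n x)) < dist x (s j)" if "j < nearest_index s n x" for j
            using that by (rule nearest_index_spec(3))
        qed
        then have "retr s m x = retr s n x" by (simp add: retr_def)
        with elim that(3) show False by simp
      qed
      with ultrametric_dist_eq[OF um less] show ?case by simp
    qed
    have "((\<lambda>x. dist x (a n)) \<longlongrightarrow> dist (a m) (a n)) U"
      by (rule tendsto_eventually) (use * in eventually_elim, simp)
    then have "dist (a m) (a n) = D (a n)" by (rule tendsto_unique[OF nb _ D])
    then have "dist (a m) (a n) = c" using Da[OF that(1)] by simp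
    with * show ?thesis by (auto elim!: eventually_mono)
  qed
  have "\<exists>N\<ge>k. \<forall>n\<ge>N. a n = a N"
  proof (cases "\<forall>n\<ge>k. a n = a k")
    case False
    then obtain N where N: "N \<ge> k" "a N \<noteq> a k" by blast
    have "a n = a N" if "n \<ge> N" for n
    proof (rule ccontr)
      assume "a n \<noteq> a N"
      from change[OF N(1) that this] change[OF order_refl N]
      have "eventually (\<lambda>x. dist x (a N) = c) U" "eventually (\<lambda>x. dist x (a N) < c) U" by blast+
      then have "eventually (\<lambda>x. False) U" by eventually_elim simp
      with nb show False by (simp add: trivial_limit_def)
    qed
    with N show ?thesis by blast
  qed blast
  then obtain N where N: "N \<ge> k" "\<And>n. n \<ge> N \<Longrightarrow> a n = a N" by blast
  show thesis
  proof (rule that[OF _ c])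
    show "a N \<in> range s" using a_range[of N] by auto
    show "((\<lambda>x. dist x (a N)) \<longlongrightarrow> c) U" using D[of "a N"] Da[OF N(1)] by simp
    show "eventually (\<lambda>x. retr s n x = a N) U" if "n \<ge> N" for n using a[of n] N(2)[OF that] by simp
  qed
qed

text \<open>
  For every \<open>n\<close>, \<open>U\<close>-almost every \<open>x\<close> lies in the fibre of \<open>r\<^sub>n\<close> that contains \<open>a\<close>, at bounded
  distance from \<open>a\<close>, and for large \<open>n\<close> a function in the predual has small Lipschitz constant on these
  fibres. This is weak-star convergence of the
  evaluations.
\<close>

lemma predual_tendsto:
  fixes s :: "nat \<Rightarrow> 'a::metric_space"
  assumes um: "ultrametric TYPE('a)" and U: "U \<noteq> bot"
    and lim: "((\<lambda>x. dist x a) \<longlongrightarrow> c) U" and "\<And>n. n \<ge> N \<Longrightarrow> eventually (\<lambda>x. retr s n x = a) U"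
    and f: "f \<in> predual z s"
  shows "(f \<longlongrightarrow> f a) U"
proof (rule tendstoI)
  fix \<epsilon> :: real assume "\<epsilon> > 0"
  have c: "c \<ge> 0" by (rule tendsto_lowerbound[OF lim _ U]) simp
  define \<delta> where "\<delta> = \<epsilon> / (c + 1)"
  have \<delta>: "\<delta> > 0" "\<delta> * (c + 1) = \<epsilon>" using \<open>\<epsilon> > 0\<close> c by (auto simp: \<delta>_def)
  obtain n where n: "\<And>x y. retr s n x = retr s n y \<Longrightarrow> \<bar>f x - f y\<bar> \<le> \<delta> * dist x y"
    using f \<delta>(1) unfolding predual_def by blast
  have "eventually (\<lambda>x. dist x a < c + 1) U" by (rule order_tendstoD[OF lim]) simp
  with assms(4)[of "max n N", OF max.cobounded2] show "eventually (\<lambda>x. dist (f x) (f a) < \<epsilon>) U"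
  proof eventually_elim
    case (elim x)
    have "retr s n x = retr s n a" using retr_retr[OF um, of n "max n N" s x] elim by simp
    then have "\<bar>f x - f a\<bar> \<le> \<delta> * dist x a" by (rule n)
    also have "\<dots> < \<delta> * (c + 1)" using elim \<delta>(1) by simp
    finally show ?case by (simp add: \<delta>(2) dist_real_def)
  qed
qed

lemma retr_tendsto:
  fixes s :: "nat \<Rightarrow> 'a::metric_space"
  assumes dense: "closure (range s) = UNIV"
  shows "(\<lambda>n. retr s n x) \<longlonglongrightarrow> x"
proof (rule metric_LIMSEQ_I)
  fix \<epsilon> :: real assume "\<epsilon> > 0"
  then obtain k where k: "dist (s k) x < \<epsilon>"
    using closure_approachable[of x "range s"] dense by auto
  have "dist (retr s n x) x < \<epsilon>" if "n \<ge> k" for n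
    using dist_retr_le[OF that, of x s] k by (simp add: dist_commute)
  then show "\<exists>n\<^sub>0. \<forall>n\<ge>n\<^sub>0. dist (retr s n x) x < \<epsilon>" by blast
qed

text \<open>
  The functions \<open>f \<circ> r\<^sub>n\<close> belong to the predual, have norm at most that of \<open>f\<close> and converge pointwise
  to \<open>f\<close>; a weak-star cluster point in the bidual does the job.
\<close>

lemma Lip0_extends_to_bidual:
  fixes s :: "nat \<Rightarrow> 'a::metric_space"
  assumes um: "ultrametric TYPE('a)" and dense: "closure (range s) = UNIV" and f: "f \<in> Lip0 (s 0)"
  obtains F where "F \<in> bidual (predual (s 0) s) lip_norm"
    "bidual_norm (predual (s 0) s) lip_norm F \<le> lip_norm f"
    "\<And>x. F (point_eval (s 0) s x) = f x"
proof -
  let ?Y = "predual (s 0) s"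
  interpret Y: normed_space_on ?Y lip_norm by (rule predual_normed_space[OF um])
  interpret D: normed_space_on "dual ?Y lip_norm" "dual_norm ?Y lip_norm" by (rule Y.dual_normed_space)
  obtain U :: "nat filter" where U: "ultrafilter U" "U \<le> sequentially"
    using ultrafilter_exists[OF sequentially_bot] .
  define g where "g n = (\<lambda>x. f (retr s n x))" for n
  have g: "g n \<in> ?Y" "lip_norm (g n) \<le> lip_norm f" for n
    unfolding g_def by (rule comp_retr_in_predual[where s = s and f = f, OF um f])+
  define F where "F = (\<lambda>\<mu>. if \<mu> \<in> dual ?Y lip_norm then Lim U (\<lambda>n. \<mu> (g n)) else 0)"
  have bound: "\<bar>\<mu> (g n)\<bar> \<le> lip_norm f * dual_norm ?Y lip_norm \<mu>" if "\<mu> \<in> dual ?Y lip_norm" for \<mu> n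
    using Y.dual_norm_bound[OF that g(1)[of n]] mult_left_mono[OF g(2)[of n] D.nonneg[OF that]]
    by (simp add: mult.commute)
  have lin: "linear_map_on (dual ?Y lip_norm) (\<lambda>\<mu>. \<mu> (g n))" for n
    by (simp add: linear_map_on_def scaleR_fun_def)
  note F_lim = Lim_bounded_functional[OF U(1) D.normed_space_on_axioms lin always_eventually[OF allI[OF bound]]]
  have F_lim': "((\<lambda>n. \<mu> (g n)) \<longlongrightarrow> F \<mu>) U" if "\<mu> \<in> dual ?Y lip_norm" for \<mu>
    using F_lim(2)[OF _ that] that by (simp add: F_def)
  show thesis
  proof (rule that)
    show "F \<in> bidual ?Y lip_norm" unfolding F_def bidual_def by (rule F_lim(1))
    show "bidual_norm ?Y lip_norm F \<le> lip_norm f"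
      unfolding bidual_norm_def
    proof (rule D.dual_norm_le)
      fix \<mu> assume \<mu>: "\<mu> \<in> dual ?Y lip_norm"
      show "\<bar>F \<mu>\<bar> \<le> lip_norm f * dual_norm ?Y lip_norm \<mu>"
        by (rule tendsto_upperbound[OF tendsto_rabs[OF F_lim'[OF \<mu>]] _ ultrafilter_nonbot[OF U(1)]])
          (simp add: bound[OF \<mu>])
    qed (rule lip_norm_nonneg[OF f])
    fix x
    obtain C where "C-lipschitz_on UNIV f" using f by (auto simp: Lip0_def)
    then have "isCont f x"
      using lipschitz_on_continuous_on continuous_on_eq_continuous_at open_UNIV by blast
    then have "(\<lambda>n. f (retr s n x)) \<longlonglongrightarrow> f x" by (rule isCont_tendsto_compose[OF _ retr_tendsto[OF dense]])
    then have "((\<lambda>n. point_eval (s 0) s x (g n)) \<longlongrightarrow> f x) U"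
      using U(2) g(1) by (simp add: point_eval_def g_def tendsto_mono)
    then show "F (point_eval (s 0) s x) = f x"
      by (rule tendsto_unique[OF ultrafilter_nonbot[OF U(1)] F_lim'[OF point_eval_in_dual[OF um]]])
  qed
qed

text \<open>
  The norm of \<open>e\<^sub>a - e\<^sub>b\<close> is attained on the predual at the distance to \<open>b\<close> composed with
  \<open>r\<^sub>n\<close>, for \<open>n\<close> so large that \<open>r\<^sub>n\<close> fixes \<open>a\<close> and \<open>b\<close>. The distance to \<open>a\<close> itself is not in the
  predual but gives an element of the bidual, and this witnesses that \<open>\<psi>\<close> has norm at least \<open>c\<close>.
\<close>

theorem proper_if_M_embedded:
  fixes s :: "nat \<Rightarrow> 'a::metric_space"
  assumes um: "ultrametric TYPE('a)" and sc: "spherically_complete TYPE('a)"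
    and inj: "inj s" and dense: "closure (range s) = UNIV"
    and emb: "M_embedded (predual (s 0) s) lip_norm"
  shows "proper_metric TYPE('a)"
proof (rule ccontr)
  assume "\<not> proper_metric TYPE('a)"
  then obtain U :: "'a filter" and p r where U: "ultrafilter U"
    and bdd: "eventually (\<lambda>x. dist p x \<le> r) U" and nonconv: "\<And>x. \<not> U \<le> nhds x"
    using nonconvergent_ultrafilter by blast
  obtain a c n\<^sub>0 where a: "a \<in> range s" and c: "c > 0" and lim_c: "((\<lambda>x. dist x a) \<longlongrightarrow> c) U"
    and stable: "\<And>n. n \<ge> n\<^sub>0 \<Longrightarrow> eventually (\<lambda>x. retr s n x = a) U"
    using stable_retraction[OF um sc dense U bdd nonconv] by blast
  note nb = ultrafilter_nonbot[OF U]
  obtain b where b: "b \<in> range s" "b \<noteq> a" using inj by (metis injD rangeI zero_neq_one)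
  let ?Y = "predual (s 0) s"
  let ?W = "bidual ?Y lip_norm" and ?NW = "bidual_norm ?Y lip_norm"
  let ?T = "dual ?W ?NW" and ?NT = "dual_norm ?W ?NW"
  interpret Y: normed_space_on ?Y lip_norm by (rule predual_normed_space[OF um])
  interpret D: normed_space_on "dual ?Y lip_norm" "dual_norm ?Y lip_norm" by (rule Y.dual_normed_space)
  interpret W: normed_space_on ?W ?NW by (rule Y.bidual_normed_space)
  interpret T: normed_space_on ?T ?NT by (rule W.dual_normed_space)
  let ?e = "point_eval (s 0) s"
  let ?\<kappa> = "canonical_embedding (dual ?Y lip_norm) (dual_norm ?Y lip_norm)"
  have e: "?e x \<in> dual ?Y lip_norm" for x by (rule point_eval_in_dual[OF um])
  have W_dual: "F \<in> dual (dual ?Y lip_norm) (dual_norm ?Y lip_norm)" if "F \<in> ?W" for F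
    using that by (simp add: bidual_def)
  have F_diff: "\<bar>F (?e x) - F (?e y)\<bar> \<le> dist x y * ?NW F" if F: "F \<in> ?W" for F x y
  proof -
    have "\<bar>F (?e x - ?e y)\<bar> \<le> ?NW F * dual_norm ?Y lip_norm (?e x - ?e y)"
      using D.dual_norm_bound[OF W_dual[OF F] D.diff_mem[OF e e]] by (simp add: bidual_norm_def)
    also have "\<dots> \<le> ?NW F * dist x y"
      by (intro mult_left_mono point_eval_diff_norm_le[OF um] W.nonneg F)
    finally show ?thesis by (simp add: D.dual_diff[OF W_dual[OF F] e e] mult.commute)
  qed
  define \<tau> where "\<tau> = ?\<kappa> (?e a - ?e b)"
  have \<tau>_app: "\<tau> F = F (?e a) - F (?e b)" if "F \<in> ?W" for F
    using that D.dual_diff[OF W_dual[OF that] e e]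
    by (simp add: \<tau>_def canonical_embedding_def bidual_def)
  obtain i j where ij: "a = s i" "b = s j" using a b by blast
  define h where "h x = dist (retr s (max i j) x) b - dist (s 0) b" for x
  have db: "(\<lambda>x. dist x y - dist (s 0) y) \<in> Lip0 (s 0)" "lip_norm (\<lambda>x. dist x y - dist (s 0) y) \<le> 1" for y
  proof -
    have "\<bar>(dist u y - dist (s 0) y) - (dist v y - dist (s 0) y)\<bar> \<le> 1 * dist u v" for u v
      using dist_triangle[of u y v] dist_triangle[of v y u] by (simp add: dist_commute)
    then show "(\<lambda>x. dist x y - dist (s 0) y) \<in> Lip0 (s 0)" "lip_norm (\<lambda>x. dist x y - dist (s 0) y) \<le> 1"
      by (intro Lip0I[of 1] lip_norm_leI; simp)+
  qed
  have h: "h \<in> ?Y" "lip_norm h \<le> 1"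
    using comp_retr_in_predual[where s = s and n = "max i j", OF um db(1)[of b]] db(2)[of b]
    unfolding h_def[abs_def] by (auto intro: order_trans)
  have ab: "dist a b \<le> dual_norm ?Y lip_norm (?e a - ?e b)"
    using Y.dual_norm_upper[OF D.diff_mem[OF e e] h, of a b] h(1) by (simp add: point_eval_def h_def ij retr_fixes)
  \<comment> \<open>the weak-star limit of \<open>e\<^sub>x - e\<^sub>a\<close> in the third dual\<close>
  have lin: "linear_map_on ?W (\<lambda>F. F (?e x) - F (?e a))" for x
    by (simp add: linear_map_on_def scaleR_fun_def algebra_simps)
  have near_a: "eventually (\<lambda>x. dist x a \<le> c + 1) U"
    using order_tendstoD(2)[OF lim_c, of "c + 1"] by (auto elim!: eventually_mono)
  have bound: "eventually (\<lambda>x. \<bar>F (?e x) - F (?e a)\<bar> \<le> (c + 1) * ?NW F) U" if F: "F \<in> ?W" for F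
    using near_a
    by eventually_elim (use F_diff[OF F] mult_right_mono[OF _ W.nonneg[OF F]] in \<open>blast intro: order_trans\<close>)
  define \<psi> where "\<psi> = (\<lambda>F. if F \<in> ?W then Lim U (\<lambda>x. F (?e x) - F (?e a)) else 0)"
  have \<psi>: "\<psi> \<in> ?T"
    unfolding \<psi>_def by (rule Lim_bounded_functional(1)[OF U W.normed_space_on_axioms lin bound])
  have \<psi>_lim: "((\<lambda>x. F (?e x) - F (?e a)) \<longlongrightarrow> \<psi> F) U" if "F \<in> ?W" for F
    using Lim_bounded_functional(2)[OF U W.normed_space_on_axioms lin bound that] that by (simp add: \<psi>_def)
  have \<psi>_zero: "\<psi> (canonical_embedding ?Y lip_norm f) = 0" if f: "f \<in> ?Y" for f
  proof -
    have "((\<lambda>x. f x - f a) \<longlongrightarrow> 0) U"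
      using predual_tendsto[OF um nb lim_c stable f] by (rule LIM_zero)
    moreover have "canonical_embedding ?Y lip_norm f (?e x) = f x" for x
      using e f by (simp add: canonical_embedding_def point_eval_def)
    ultimately show ?thesis
      using tendsto_unique[OF nb \<psi>_lim[OF Y.canonical_embedding_in_bidual[OF f]]] by simp
  qed
  have \<psi>_norm: "c \<le> ?NT \<psi>"
  proof -
    obtain F where F: "F \<in> ?W" "?NW F \<le> lip_norm (\<lambda>x. dist x a - dist (s 0) a)"
      "\<And>x. F (?e x) = dist x a - dist (s 0) a"
      using Lip0_extends_to_bidual[OF um dense db(1)[of a]] by blast
    have "\<psi> F = c" using tendsto_unique[OF nb \<psi>_lim[OF F(1)]] lim_c by (simp add: F(3))
    with W.dual_norm_upper[OF \<psi> F(1)] F(2) db(2)[of a] show ?thesis by simp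
  qed
  have "?NT (\<tau> + \<psi>) \<le> max c (dist a b)"
  proof (rule W.dual_norm_le)
    fix F assume F: "F \<in> ?W"
    have "((\<lambda>x. \<bar>F (?e x) - F (?e b)\<bar>) \<longlongrightarrow> \<bar>(\<tau> + \<psi>) F\<bar>) U"
      using tendsto_rabs[OF tendsto_add[OF tendsto_const[of "\<tau> F"] \<psi>_lim[OF F]]] by (simp add: \<tau>_app[OF F])
    moreover have "((\<lambda>x. max (dist x a) (dist a b) * ?NW F) \<longlongrightarrow> max c (dist a b) * ?NW F) U"
      by (intro tendsto_intros lim_c)
    moreover have "\<bar>F (?e x) - F (?e b)\<bar> \<le> max (dist x a) (dist a b) * ?NW F" for x
      using F_diff[OF F, of x b] mult_right_mono[OF ultrametricD[OF um, of x b a] W.nonneg[OF F]] by linarith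
    ultimately show "\<bar>(\<tau> + \<psi>) F\<bar> \<le> max c (dist a b) * ?NW F"
      by (intro tendsto_le[OF nb]) auto
  qed (use c in simp)
  moreover have "?NT (\<tau> + \<psi>) = dual_norm ?Y lip_norm (?e a - ?e b) + ?NT \<psi>"
    unfolding \<tau>_def using Y.M_embedded_norm_add[OF emb D.diff_mem[OF e e]] \<psi> \<psi>_zero
    by (auto simp: annihilator_def)
  moreover have "dist a b > 0" using b(2) by simp
  ultimately show False using \<psi>_norm ab c by linarith
qed

theorem proposition4p14:
  fixes z :: "'a::metric_space" and s :: "nat \<Rightarrow> 'a"
  assumes "ultrametric TYPE('a)"
    and "spherically_complete TYPE('a)"
    and "inj s"
    and "closure (range s) = UNIV"
    and "s 0 = z"
  shows "M_embedded (predual z s) lip_norm \<longleftrightarrow> proper_metric TYPE('a)"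
  using M_embedded_if_proper[of s] proper_if_M_embedded[of s] assms by blast

end
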